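(* Let $(T_0,\widetilde{T}_0)$ be a joint pair of abstract Friedrichs operators on a complex Hilbert space $\mathcal{H}$ and let $T$ be a closed realisation of $T_0$, i.e. a closed operator with $T_0\subseteq T\subseteq T_1$. For a linear operator $U$ with domain $\operatorname{dom}U\subseteq\ker\widetilde{T}_1$ and values in $\ker T_1$ put $$\mathcal{V}_U:=\{u_0+U\tilde\nu+\tilde\nu : u_0\in\mathcal{W}_0,\ \tilde\nu\in\operatorname{dom}U\}.$$ (i) $T$ is bijective (as a map $\operatorname{dom}T\to\mathcal{H}$) if and only if there exists a bounded operator $U:\ker\widetilde{T}_1\to\ker T_1$ such that $\operatorname{dom}T=\mathcal{V}_U$. (ii) $\operatorname{dom}T\subseteq\mathcal{W}^+$ if and only if there exist a closed subspace $\widetilde{\mathcal{G}}\subseteq\ker\widetilde{T}_1$ and a non-expansive linear operator $U:(\widetilde{\mathcal{G}},[\cdot\mid\cdot])\to(\ker T_1,-[\cdot\mid\cdot])$ (i.e. the norm of $U$ with respect to the indicated norms is at most $1$) such that $\operatorname{dom}T=\mathcal{V}_U$. (iii) $T$ is a bijective realisation with signed boundary map if and only if there exists a non-expansive linear operator $U:(\ker\widetilde{T}_1,[\cdot\mid\cdot])\to(\ker T_1,-[\cdot\mid\cdot])$ such that $\operatorname{dom}T=\mathcal{V}_U$. (iv) $\operatorname{dom}T\subseteq\operatorname{dom}T^*$ if and only if there exist closed subspaces $\widetilde{\mathcal{G}}\subseteq\ker\widetilde{T}_1$ and $\mathcal{G}\subseteq\ker T_1$ and a unitary transformation $U:(\widetilde{\mathcal{G}},[\cdot\mid\cdot])\to(\mathcal{G},-[\cdot\mid\cdot])$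 such that $\operatorname{dom}T=\mathcal{V}_U$. (v) $\operatorname{dom}T=\operatorname{dom}T^*$ if and only if there exists a unitary transformation $U:(\ker\widetilde{T}_1,[\cdot\mid\cdot])\to(\ker T_1,-[\cdot\mid\cdot])$ such that $\operatorname{dom}T=\mathcal{V}_U$. (vi) In each of the cases (i)–(v), the mapping $U\mapsto T_1|_{\mathcal{V}_U}$ establishes a one-to-one correspondence between the realisations $T$ (equivalently, their domains $\operatorname{dom}T$) and the classifying operators $U$ of the respective type.
   Context: $\langle\cdot\mid\cdot\rangle$ is the scalar product of $\mathcal{H}$, anti-linear in the second entry. A joint pair of abstract Friedrichs operators is a pair $(T_0,\widetilde{T}_0)$ of linear operators on $\mathcal{H}$ such that: (T1) they have a common domain $\mathcal{D}$, dense in $\mathcal{H}$, and $\langle T_0\phi\mid\psi\rangle=\langle\phi\mid\widetilde{T}_0\psi\rangle$ for $\phi,\psi\in\mathcal{D}$; (T2) there is $\lambda>0$ with $\|(T_0+\widetilde{T}_0)\phi\|\le2\lambda\|\phi\|$ for $\phi\in\mathcal{D}$; (T3) there is $\mu>0$ with $\langle(T_0+\widetilde{T}_0)\phi\mid\phi\rangle\ge2\mu\|\phi\|^2$ for $\phi\in\mathcal{D}$. Notation: $T_1:=\widetilde{T}_0^*$, $\widetilde{T}_1:=T_0^*$ (so $T_0\subseteq T_1$, $\widetilde{T}_0\subseteq\widetilde{T}_1$); $\mathcal{W}_0:=\operatorname{dom}\overline{T}_0=\operatorname{dom}\overline{\widetilde{T}}_0$ and $\mathcal{W}:=\operatorname{dom}T_1=\operatorname{dom}\widetilde{T}_1$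 (these equalities are known to hold). $\mathcal{W}$ (the graph space) carries the graph norm $\|u\|_{T_1}=\|u\|+\|T_1u\|$, which is equivalent to that of $\widetilde{T}_1$. On $\mathcal{W}$ define the sesquilinear (indefinite inner product) form $$[u\mid v]:=\langle T_1u\mid v\rangle-\langle u\mid\widetilde{T}_1v\rangle,$$ and put $\mathcal{W}^{+}:=\{u\in\mathcal{W}:[u\mid u]\ge0\}$, $\mathcal{W}^{-}:=\{u\in\mathcal{W}:[u\mid u]\le0\}$, $X^{[\perp]}:=\{u\in\mathcal{W}:[u\mid v]=0\ \text{for all } v\in X\}$ for $X\subseteq\mathcal{W}$. It is known that $\mathcal{W}=\mathcal{W}_0\dotplus\ker T_1\dotplus\ker\widetilde{T}_1$ (direct, pairwise $[\cdot\mid\cdot]$-orthogonal), and that $(\ker T_1,-[\cdot\mid\cdot])$ and $(\ker\widetilde{T}_1,[\cdot\mid\cdot])$ are Hilbert spaces whose norms are equivalent to the norm of $\mathcal{H}$. A realisation $T=T_1|_{\mathcal{V}}$, with $\mathcal{V}$ a closed subspace of $\mathcal{W}$ (in the graph norm) containing $\mathcal{W}_0$, is called a bijective realisation with signed boundary map if $\mathcal{V}\subseteq\mathcal{W}^+$ and $\mathcal{V}^{[\perp]}\subseteq\mathcal{W}^-$ (in which case $T_1|_{\mathcal{V}}:\mathcal{V}\to\mathcal{H}$ and $\widetilde{T}_1|_{\mathcal{V}^{[\perp]}}:\mathcal{V}^{[\perp]}\to\mathcal{H}$ are known to be bijective). A unitary transformation is a linear surjective isometry between Hilbert spaces. *)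

theory Defs
  imports "HOL-Analysis.Analysis" "HOL-Library.Complex_Order"
begin

section \<open>Complex Hilbert spaces\<close>

text \<open>A complex Hilbert space is a complete real inner product space with a compatible complex
  scalar multiplication and a sesquilinear scalar product \<open>cinner\<close>, linear in the first and
  antilinear in the second entry, whose real part is the real inner product of the library.
  In particular the norm and topology of the library are those induced by \<open>cinner\<close>.\<close>

class chilbert_space = real_inner + complete_space +
  fixes scaleC :: "complex \<Rightarrow> 'a \<Rightarrow> 'a"  (infixr "*\<^sub>C" 75)
    and cinner :: "'a \<Rightarrow> 'a \<Rightarrow> complex"
  assumes scaleC_add_right: "a *\<^sub>C (x + y) = a *\<^sub>C x + a *\<^sub>C y"
    and scaleC_add_left: "(a + b) *\<^sub>C x = a *\<^sub>C x + b *\<^sub>C x"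
    and scaleC_scaleC: "a *\<^sub>C (b *\<^sub>C x) = (a * b) *\<^sub>C x"
    and scaleC_of_real: "complex_of_real r *\<^sub>C x = r *\<^sub>R x"
    and cinner_commute: "cinner x y = cnj (cinner y x)"
    and cinner_add_left: "cinner (x + y) z = cinner x z + cinner y z"
    and cinner_scaleC_left: "cinner (a *\<^sub>C x) y = a * cinner x y"
    and inner_eq_Re_cinner: "inner x y = Re (cinner x y)"
begin

subclass banach ..

lemma cinner_self: "cinner x x = complex_of_real ((norm x)\<^sup>2)"
proof (rule complex_eqI)
  show "Re (cinner x x) = Re (complex_of_real ((norm x)\<^sup>2))"
    by (metis Re_complex_of_real inner_eq_Re_cinner power2_norm_eq_inner)
  have "Im (cinner x x) = - Im (cinner x x)"
    by (subst cinner_commute) simp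
  then show "Im (cinner x x) = Im (complex_of_real ((norm x)\<^sup>2))"
    by simp
qed

end

instantiation complex :: chilbert_space
begin

definition scaleC_complex :: "complex \<Rightarrow> complex \<Rightarrow> complex"
  where "scaleC_complex a x = a * x"

definition cinner_complex :: "complex \<Rightarrow> complex \<Rightarrow> complex"
  where "cinner_complex x y = x * cnj y"

instance
  by standard
    (auto simp: scaleC_complex_def cinner_complex_def inner_complex_def algebra_simps
      scaleR_conv_of_real)

end

instantiation prod :: (chilbert_space, chilbert_space) chilbert_space
begin

definition scaleC_prod :: "complex \<Rightarrow> 'a \<times> 'b \<Rightarrow> 'a \<times> 'b"
  where "scaleC_prod a p = (a *\<^sub>C fst p, a *\<^sub>C snd p)"

definition cinner_prod :: "'a \<times> 'b \<Rightarrow> 'a \<times> 'b \<Rightarrow> complex"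
  where "cinner_prod p q = cinner (fst p) (fst q) + cinner (snd p) (snd q)"

instance
proof
  fix p q :: "'a \<times> 'b"
  show "cinner p q = cnj (cinner q p)"
    unfolding cinner_prod_def
    by (simp add: cinner_commute[of "fst p"] cinner_commute[of "snd p"])
qed (auto simp: scaleC_prod_def cinner_prod_def scaleC_add_right scaleC_add_left scaleC_scaleC
      scaleC_of_real cinner_add_left cinner_scaleC_left inner_prod_def inner_eq_Re_cinner
      prod_eq_iff algebra_simps)

end

definition csubspace :: "'a::chilbert_space set \<Rightarrow> bool"
  where "csubspace S \<longleftrightarrow>
    0 \<in> S \<and> (\<forall>x\<in>S. \<forall>y\<in>S. x + y \<in> S) \<and> (\<forall>a. \<forall>x\<in>S. a *\<^sub>C x \<in> S)"

section \<open>Unbounded operators as graphs\<close>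

text \<open>A linear operator is identified with its graph, a single-valued subspace of the product.
  Hence \<open>Domain T\<close> and \<open>Range T\<close> are its domain and range, \<open>T \<subseteq> S\<close> says that \<open>S\<close> extends \<open>T\<close>,
  and \<open>closed T\<close> and \<open>closure T\<close> have their operator-theoretic meaning.\<close>

type_synonym 'a operator = "('a \<times> 'a) set"

definition linear_op :: "'a::chilbert_space operator \<Rightarrow> bool"
  where "linear_op T \<longleftrightarrow> csubspace T \<and> single_valued T"

definition app :: "'a operator \<Rightarrow> 'a \<Rightarrow> 'a"
  where "app T x = (THE y. (x, y) \<in> T)"

lemma app_eq: "single_valued T \<Longrightarrow> (x, y) \<in> T \<Longrightarrow> app T x = y"
  by (auto simp: app_def single_valued_def)

definition ker :: "'a::chilbert_space operator \<Rightarrow> 'a set"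
  where "ker T = {x. (x, 0) \<in> T}"

definition restrict_op :: "'a operator \<Rightarrow> 'a set \<Rightarrow> 'a operator"
  where "restrict_op T V = T \<inter> (V \<times> UNIV)"

definition bijective_op :: "'a operator \<Rightarrow> bool"
  where "bijective_op T \<longleftrightarrow> bij_betw (app T) (Domain T) UNIV"

text \<open>This relation is single-valued exactly if \<open>T\<close> is densely defined.\<close>

definition adjoint_op :: "'a::chilbert_space operator \<Rightarrow> 'a operator"
  where "adjoint_op T = {(v, w). \<forall>(u, z)\<in>T. cinner z v = cinner u w}"

section \<open>Abstract Friedrichs operators\<close>

text \<open>The inequality in the last condition is the order of \<open>Complex_Order\<close>: \<open>z \<ge> r\<close> for real \<open>r\<close>
  means that \<open>z\<close> is real and at least \<open>r\<close>.\<close>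

definition joint_friedrichs_pair ::
    "'a::chilbert_space operator \<Rightarrow> 'a operator \<Rightarrow> bool"
  where "joint_friedrichs_pair T0 Tt0 \<longleftrightarrow>
    linear_op T0 \<and> linear_op Tt0 \<and>
    Domain T0 = Domain Tt0 \<and> closure (Domain T0) = UNIV \<and>
    (\<forall>\<phi>\<in>Domain T0. \<forall>\<psi>\<in>Domain T0. cinner (app T0 \<phi>) \<psi> = cinner \<phi> (app Tt0 \<psi>)) \<and>
    (\<exists>l>0. \<forall>\<phi>\<in>Domain T0. norm (app T0 \<phi> + app Tt0 \<phi>) \<le> 2 * l * norm \<phi>) \<and>
    (\<exists>\<mu>>0. \<forall>\<phi>\<in>Domain T0.
      cinner (app T0 \<phi> + app Tt0 \<phi>) \<phi> \<ge> complex_of_real (2 * \<mu> * (norm \<phi>)\<^sup>2))"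

definition closed_realisation ::
    "'a::chilbert_space operator \<Rightarrow> 'a operator \<Rightarrow> 'a operator \<Rightarrow> bool"
  where "closed_realisation T0 T1 T \<longleftrightarrow> linear_op T \<and> closed T \<and> T0 \<subseteq> T \<and> T \<subseteq> T1"

text \<open>Meaningful for \<open>u\<close> in the domain of \<open>T1\<close> and \<open>v\<close> in the domain of \<open>Tt1\<close>; these coincide for
  a joint pair.\<close>

definition boundary_form ::
    "'a::chilbert_space operator \<Rightarrow> 'a operator \<Rightarrow> 'a \<Rightarrow> 'a \<Rightarrow> complex"
  where "boundary_form T1 Tt1 u v = cinner (app T1 u) v - cinner u (app Tt1 v)"

definition nonneg_cone :: "'a set \<Rightarrow> ('a \<Rightarrow> 'a \<Rightarrow> complex) \<Rightarrow> 'a set"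
  where "nonneg_cone W B = {u\<in>W. B u u \<ge> 0}"

definition nonpos_cone :: "'a set \<Rightarrow> ('a \<Rightarrow> 'a \<Rightarrow> complex) \<Rightarrow> 'a set"
  where "nonpos_cone W B = {u\<in>W. B u u \<le> 0}"

definition form_orthogonal :: "'a set \<Rightarrow> ('a \<Rightarrow> 'a \<Rightarrow> complex) \<Rightarrow> 'a set \<Rightarrow> 'a set"
  where "form_orthogonal W B X = {u\<in>W. \<forall>v\<in>X. B u v = 0}"

definition graph_norm :: "'a::chilbert_space operator \<Rightarrow> 'a \<Rightarrow> real"
  where "graph_norm T u = norm u + norm (app T u)"

text \<open>Subspaces of \<open>Domain T\<close> closed with respect to the graph norm.\<close>

definition graph_closed_subspace :: "'a::chilbert_space operator \<Rightarrow> 'a set \<Rightarrow> bool"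
  where "graph_closed_subspace T V \<longleftrightarrow>
    csubspace V \<and> V \<subseteq> Domain T \<and>
    (\<forall>s u. (\<forall>n::nat. s n \<in> V) \<and> u \<in> Domain T \<and> (\<lambda>n. graph_norm T (s n - u)) \<longlonglongrightarrow> 0 \<longrightarrow> u \<in> V)"

definition signed_boundary_realisation ::
    "'a::chilbert_space operator \<Rightarrow> 'a set \<Rightarrow> ('a \<Rightarrow> 'a \<Rightarrow> complex) \<Rightarrow> 'a operator \<Rightarrow> bool"
  where "signed_boundary_realisation T1 W0 B T \<longleftrightarrow>
    (\<exists>V. graph_closed_subspace T1 V \<and> W0 \<subseteq> V \<and> T = restrict_op T1 V \<and>
      V \<subseteq> nonneg_cone (Domain T1) B \<and>
      form_orthogonal (Domain T1) B V \<subseteq> nonpos_cone (Domain T1) B)"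

section \<open>Classifying operators\<close>

definition V_dom :: "'a::chilbert_space set \<Rightarrow> 'a operator \<Rightarrow> 'a set"
  where "V_dom W0 U = {u0 + app U \<nu> + \<nu> | u0 \<nu>. u0 \<in> W0 \<and> \<nu> \<in> Domain U}"

definition operator_between ::
    "'a::chilbert_space set \<Rightarrow> 'a set \<Rightarrow> 'a operator \<Rightarrow> bool"
  where "operator_between G K U \<longleftrightarrow> linear_op U \<and> Domain U = G \<and> Range U \<subseteq> K"

definition bounded_operator ::
    "'a::chilbert_space set \<Rightarrow> 'a set \<Rightarrow> 'a operator \<Rightarrow> bool"
  where "bounded_operator G K U \<longleftrightarrow>
    operator_between G K U \<and> (\<exists>C. \<forall>x\<in>G. norm (app U x) \<le> C * norm x)"

definition closed_subspace_of :: "'a::chilbert_space set \<Rightarrow> 'a set \<Rightarrow> bool"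
  where "closed_subspace_of G K \<longleftrightarrow> csubspace G \<and> closed G \<and> G \<subseteq> K"

text \<open>The norm of an inner product \<open>B\<close> (on a subspace where \<open>B\<close> is one).\<close>

definition form_norm :: "('a \<Rightarrow> 'a \<Rightarrow> complex) \<Rightarrow> 'a \<Rightarrow> real"
  where "form_norm B x = sqrt (Re (B x x))"

text \<open>Operators from \<open>(G, B)\<close> to \<open>(K, C)\<close>, where \<open>B\<close> and \<open>C\<close> are the inner products.\<close>

definition nonexpansive_operator ::
    "'a::chilbert_space set \<Rightarrow> ('a \<Rightarrow> 'a \<Rightarrow> complex) \<Rightarrow> 'a set \<Rightarrow> ('a \<Rightarrow> 'a \<Rightarrow> complex)
      \<Rightarrow> 'a operator \<Rightarrow> bool"
  where "nonexpansive_operator G B K C U \<longleftrightarrow>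
    operator_between G K U \<and> (\<forall>x\<in>G. form_norm C (app U x) \<le> form_norm B x)"

definition unitary_operator ::
    "'a::chilbert_space set \<Rightarrow> ('a \<Rightarrow> 'a \<Rightarrow> complex) \<Rightarrow> 'a set \<Rightarrow> ('a \<Rightarrow> 'a \<Rightarrow> complex)
      \<Rightarrow> 'a operator \<Rightarrow> bool"
  where "unitary_operator G B K C U \<longleftrightarrow>
    operator_between G K U \<and> Range U = K \<and> (\<forall>x\<in>G. form_norm C (app U x) = form_norm B x)"

text \<open>One-to-one correspondence of a set \<open>Us\<close> of classifying operators with a set \<open>Ts\<close> of
  realisations, and with the set of their domains.\<close>

definition classifies ::
    "'a::chilbert_space operator \<Rightarrow> 'a set \<Rightarrow> 'a operator set \<Rightarrow> 'a operator set \<Rightarrow> bool"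
  where "classifies T1 W0 Us Ts \<longleftrightarrow>
    bij_betw (\<lambda>U. restrict_op T1 (V_dom W0 U)) Us Ts \<and>
    bij_betw (V_dom W0) Us (Domain ` Ts)"

end

theory Submission
  imports Defs
begin

text \<open>The sum of the two operators extends to a bounded hermitian coercive operator \<open>S\<close>, and
  \<open>\<langle>T\<^sub>1 u | v\<rangle> + \<langle>u | T\<^sub>1 v\<rangle> = [u | v] + \<langle>S u | v\<rangle>\<close> on \<open>\<W>\<close>. Solving coercive equations on \<open>ker T\<^sub>1~\<close> shows that
  \<open>T\<^sub>1\<close> maps \<open>\<W>\<^sub>0 + ker T\<^sub>1~\<close> onto \<open>\<H>\<close>, whence \<open>\<W> = \<W>\<^sub>0 + ker T\<^sub>1 + ker T\<^sub>1~\<close> with components that depend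
  continuously on the graph norm. A closed subspace \<open>\<V> \<supseteq> \<W>\<^sub>0\<close> of \<open>\<W>\<close> is therefore determined by the
  closed relation \<open>{(x, y) \<in> ker T\<^sub>1~ \<times> ker T\<^sub>1. y + x \<in> \<V>}\<close>, which is the graph of \<open>U\<close> as soon as
  \<open>\<V> \<inter> ker T\<^sub>1 = {0}\<close>. On \<open>\<V>\<^sub>U\<close> the form is \<open>[u | u] = [U x | U x] + [x | x]\<close>, so sign conditions on \<open>\<V>\<close>
  become norm conditions on \<open>U\<close>; the domain of the adjoint is the orthogonal complement of \<open>\<V>\<close> for the
  form; and bijectivity of \<open>T\<close> means that \<open>U\<close> is everywhere defined, hence bounded by the closed graph
  theorem.\<close>

section \<open>Closed graphs and coercive forms\<close>

text \<open>The identity for the form says that the second maximal operator is \<open>S - T1\<close>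
  on \<open>W\<close>. One function \<open>L\<close> therefore carries both operators:
  \<open>K\<close> is \<open>L = 0\<close>, \<open>Kt\<close> is \<open>L = S\<close>, and the form
  is the coercive product \<open>cinner (S x) x'\<close> on \<open>Kt\<close> and its negative on
  \<open>K\<close>. Coercivity of \<open>S\<close> thus supplies definiteness on the kernels, the
  form-orthogonal projections inside them and the estimates for the components. The cases ask for
  different regularity of \<open>U\<close>: bounded, contractive with closed domain, unitary. All
  are brought to closed graphs in \<open>Kt \<times> K\<close>, for which the correspondence with
  subspaces is settled once; closedness of domain and range is exchanged against closedness of the
  graph by a norm bound. A full domain has two sources: surjectivity of \<open>T\<close> in (i),
  definiteness in (iii) and (v), where a vector of \<open>Kt\<close> orthogonal to
  \<open>Domain U\<close> lies in the form complement of \<open>Domain T\<close>, whose sign or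
  isotropy makes it vanish.\<close>

lemma closed_graph_bounded_on:
  fixes f :: "'a::banach \<Rightarrow> 'b::banach"
  assumes G: "subspace G" "closed G"
    and add: "\<And>x y. x \<in> G \<Longrightarrow> y \<in> G \<Longrightarrow> f (x + y) = f x + f y"
    and scale: "\<And>r x. x \<in> G \<Longrightarrow> f (r *\<^sub>R x) = r *\<^sub>R f x"
    and graph: "closed {(x, f x) | x. x \<in> G}"
  shows "\<exists>C. \<forall>x\<in>G. norm (f x) \<le> C * norm x"
proof -
  have diff: "f (x - y) = f x - f y" if "x \<in> G" "y \<in> G" for x y
    using add[of "x - y" y] that subspace_diff[OF G(1)] by simp
  \<comment> \<open>Baire category on the complete space \<open>G\<close>: countably many closed
    sets cover \<open>G\<close>, so one has interior relative to \<open>G\<close>. The closure is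
    taken because the sublevel sets themselves are not known to be closed.\<close>
  define A where "A n = closure {x\<in>G. norm (f x) \<le> real n}" for n :: nat
  have A_sub: "A n \<subseteq> G" for n
    unfolding A_def by (rule closure_minimal) (use G in auto)
  have "G \<subseteq> \<Union>(range A)"
  proof
    fix x assume "x \<in> G"
    moreover obtain n :: nat where "norm (f x) \<le> real n"
      using real_arch_simple by blast
    ultimately have "x \<in> A n"
      unfolding A_def by (intro subsetD[OF closure_subset]) auto
    then show "x \<in> \<Union>(range A)" by blast
  qed
  then have un: "\<Union>(range A) = G"
    using A_sub by blast
  have "\<exists>n. (top_of_set G) interior_of (A n) \<noteq> {}"
  proof (rule ccontr)
    assume neg: "\<not> ?thesis"
    have "(top_of_set G) interior_of (\<Union>(range A)) = {}"
    proof (rule Baire_category_alt)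
      have "completely_metrizable_space (top_of_set G)"
        by (intro completely_metrizable_space_closedin completely_metrizable_space_euclidean)
          (use G in auto)
      then show "completely_metrizable_space (top_of_set G) \<or>
          locally_compact_space (top_of_set G) \<and> regular_space (top_of_set G)" ..
      fix T assume "T \<in> range A"
      then obtain n where "T = A n" by blast
      moreover have "closed (A n)"
        by (simp add: A_def)
      ultimately show "closedin (top_of_set G) T \<and> (top_of_set G) interior_of T = {}"
        using neg A_sub[of n] by (auto intro: closed_subset)
    qed simp
    then have "G = {}"
      using interior_of_topspace[of "top_of_set G"] un by simp
    then show False
      using subspace_0[OF G(1)] by simp
  qed
  then obtain n x0 where "x0 \<in> (top_of_set G) interior_of (A n)"
    by blast
  then obtain T where T: "openin (top_of_set G) T" "x0 \<in> T" "T \<subseteq> A n"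
    by (auto simp: interior_of_def)
  then obtain e where e: "e > 0" "ball x0 e \<inter> G \<subseteq> A n"
    by (meson openin_contains_ball subset_trans)
  have x0: "x0 \<in> A n" "x0 \<in> G"
    using T A_sub by auto
  \<comment> \<open>Approximants \<open>a\<close> of \<open>x0 + t *\<^sub>R y\<close> and
    \<open>b\<close> of \<open>x0\<close> satisfy \<open>norm (f (a - b)) \<le> 2 * n\<close>;
    undoing the factor \<open>t = e / (2 * norm y)\<close> turns this bound into
    \<open>4 * n / e * norm y\<close>. Precision \<open>e / 8\<close> for each approximant leaves
    half of \<open>norm y\<close> after rescaling.\<close>
  define C where "C = 4 * real n / e"
  have step: "\<exists>a\<in>G. norm (y - a) \<le> norm y / 2 \<and> norm (f a) \<le> C * norm y" if y: "y \<in> G" for y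
  proof (cases "y = 0")
    case True
    then show ?thesis
      using diff[of 0 0] subspace_0[OF G(1)] by (intro bexI[of _ 0]) auto
  next
    case False
    define t where "t = e / (2 * norm y)"
    have t: "t > 0"
      using False e by (simp add: t_def)
    have nt: "norm (t *\<^sub>R y) = e / 2"
      using False e by (simp add: t_def)
    have "x0 + t *\<^sub>R y \<in> ball x0 e \<inter> G"
      using nt e x0 y G(1) by (auto simp: dist_norm subspace_add subspace_scale)
    then have y': "x0 + t *\<^sub>R y \<in> A n"
      using e by blast
    have e8: "e / 8 > 0" using e by simp
    obtain a where a: "a \<in> G" "norm (f a) \<le> n" "dist a (x0 + t *\<^sub>R y) < e / 8"
      using y' e8 unfolding A_def closure_approachable by blast
    obtain b where b: "b \<in> G" "norm (f b) \<le> n" "dist b x0 < e / 8"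
      using x0(1) e8 unfolding A_def closure_approachable by blast
    define d where "d = inverse t *\<^sub>R (a - b)"
    have ab: "a - b \<in> G"
      using a b G(1) by (simp add: subspace_diff)
    have "y - d = inverse t *\<^sub>R (t *\<^sub>R y - (a - b))"
      using t by (simp add: d_def scaleR_diff_right)
    moreover have "norm (t *\<^sub>R y - (a - b)) \<le> e / 4"
    proof -
      have eq: "t *\<^sub>R y - (a - b) = (b - x0) - (a - (x0 + t *\<^sub>R y))"
        by simp
      show ?thesis
        using norm_triangle_ineq4[of "b - x0" "a - (x0 + t *\<^sub>R y)"] a(3) b(3)
        unfolding eq dist_norm by linarith
    qed
    ultimately have "norm (y - d) \<le> inverse t * (e / 4)"
      using t by simp
    also have "\<dots> = norm y / 2"
      using e by (simp add: t_def field_simps)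
    finally have 1: "norm (y - d) \<le> norm y / 2" .
    have "norm (f (a - b)) \<le> 2 * real n"
      using norm_triangle_ineq4[of "f a" "f b"] a b by (simp add: diff)
    then have "norm (f d) \<le> inverse t * (2 * real n)"
      using t ab by (simp add: d_def scale)
    also have "\<dots> = C * norm y"
      using e by (simp add: t_def C_def field_simps)
    finally have "norm (f d) \<le> C * norm y" .
    moreover have "d \<in> G"
      using ab G(1) by (simp add: d_def subspace_scale)
    ultimately show ?thesis
      using 1 by blast
  qed
  then obtain g where g: "\<And>y. y \<in> G \<Longrightarrow> g y \<in> G" "\<And>y. y \<in> G \<Longrightarrow> norm (y - g y) \<le> norm y / 2"
      "\<And>y. y \<in> G \<Longrightarrow> norm (f (g y)) \<le> C * norm y"
    by metis
  have C0: "C \<ge> 0"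
    using e by (simp add: C_def)
  have "norm (f x) \<le> 2 * C * norm x" if x: "x \<in> G" for x
  proof -
    \<comment> \<open>Successive approximation: the residuals halve, so they tend to 0 and the
      increments of \<open>f (r k)\<close> are dominated by a geometric series. Hence
      \<open>f (r n)\<close> converges, the closed graph forces the limit to be
      \<open>f 0 = 0\<close>, and telescoping bounds \<open>f x\<close> by the sum of the
      series.\<close>
    define r where "r k = ((\<lambda>y. y - g y) ^^ k) x" for k
    have r_Suc: "r (Suc k) = r k - g (r k)" for k
      by (simp add: r_def)
    have r_G: "r k \<in> G" for k
      by (induction k) (use x g G(1) in \<open>auto simp: r_Suc subspace_diff, simp add: r_def\<close>)
    have r_norm: "norm (r k) \<le> norm x * (1 / 2) ^ k" for k
    proof (induction k)
      case (Suc k)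
      then show ?case
        using g(2)[OF r_G[of k]] by (simp add: r_Suc)
    qed (simp add: r_def)
    define d where "d k = f (r (Suc k)) - f (r k)" for k
    have d_norm: "norm (d k) \<le> (C * norm x) * (1 / 2) ^ k" for k
    proof -
      have "d k = - f (g (r k))"
        using r_G g(1) by (simp add: d_def r_Suc diff)
      then have "norm (d k) \<le> C * norm (r k)"
        using g(3)[OF r_G[of k]] by simp
      also have "\<dots> \<le> C * (norm x * (1 / 2) ^ k)"
        using r_norm C0 by (intro mult_left_mono)
      finally show ?thesis by (simp add: mult.assoc)
    qed
    have geo: "(\<lambda>k. (C * norm x) * (1 / 2) ^ k) sums ((C * norm x) * 2)"
      using sums_mult[OF geometric_sums[of "1/2::real"], of "C * norm x"] by simp
    have sn: "summable (\<lambda>k. norm (d k))"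
      by (rule summable_comparison_test'[OF sums_summable[OF geo], of 0]) (use d_norm in auto)
    then have "summable d"
      by (rule summable_norm_cancel)
    then have lim: "(\<lambda>n. f (r n) - f (r 0)) \<longlonglongrightarrow> suminf d"
      using summable_LIMSEQ[of d] sum_lessThan_telescope[of "\<lambda>n. f (r n)"] by (simp add: d_def)
    have "(\<lambda>n. norm x * (1 / 2) ^ n) \<longlonglongrightarrow> 0"
      by (intro tendsto_mult_right_zero LIMSEQ_power_zero) simp
    then have r0: "r \<longlonglongrightarrow> 0"
      by (rule Lim_null_comparison[rotated]) (use r_norm in auto)
    have "(\<lambda>n. (r n, f (r n))) \<longlonglongrightarrow> (0, suminf d + f (r 0))"
      using tendsto_add[OF lim tendsto_const[of "f (r 0)"]] by (intro tendsto_Pair r0) simp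
    then have "(0, suminf d + f (r 0)) \<in> {(x, f x) | x. x \<in> G}"
      by (rule closed_sequentially[OF graph, rotated]) (use r_G in auto)
    then have "suminf d + f x = 0"
      using diff[of 0 0] subspace_0[OF G(1)] by (auto simp: r_def)
    then have "norm (f x) = norm (suminf d)"
      by (metis add.commute add_eq_0_iff norm_minus_cancel)
    also have "\<dots> \<le> (\<Sum>k. norm (d k))"
      by (rule summable_norm[OF sn])
    also have "\<dots> \<le> (C * norm x) * 2"
      using suminf_le[OF d_norm sn sums_summable[OF geo]] sums_unique[OF geo] by simp
    finally show ?thesis by (simp add: mult_ac)
  qed
  then show ?thesis by blast
qed

text \<open>Dirichlet principle: the quadratic functional \<open>J\<close> is bounded below and
  attains its infimum on \<open>G\<close>, and the vanishing of its first variation is the equation.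
  With the identity for \<open>S\<close> this is orthogonal projection onto
  \<open>G\<close>.\<close>

lemma symmetric_coercive_solution:
  fixes S :: "'a::{real_inner, complete_space} \<Rightarrow> 'a"
  assumes S: "bounded_linear S" and sym: "\<And>x y. inner (S x) y = inner x (S y)"
    and c: "c > 0" and coercive: "\<And>x. c * (norm x)\<^sup>2 \<le> inner (S x) x"
    and G: "subspace G" "closed G"
  shows "\<exists>g\<in>G. \<forall>x\<in>G. inner (S g) x = inner f x"
proof -
  interpret S: bounded_linear S by fact
  define J where "J g = inner (S g) g - 2 * inner f g" for g
  have J_ge: "J g \<ge> - (norm f)\<^sup>2 / c" for g
  proof -
    have "0 \<le> (c * norm g - norm f)\<^sup>2 / c"
      using c by simp
    also have "\<dots> = c * (norm g)\<^sup>2 - 2 * (norm f * norm g) + (norm f)\<^sup>2 / c"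
      using c by (simp add: power2_eq_square field_simps)
    also have "\<dots> \<le> J g + (norm f)\<^sup>2 / c"
      using coercive[of g] norm_cauchy_schwarz[of f g] by (simp add: J_def)
    finally show ?thesis by simp
  qed
  then have bdd: "bdd_below (J ` G)"
    by (intro bdd_belowI2)
  define m where "m = Inf (J ` G)"
  have m: "m \<le> J g" if "g \<in> G" for g
    unfolding m_def by (rule cInf_lower) (use that bdd in auto)
  have "\<exists>g\<in>G. J g < m + inverse (real (Suc n))" for n
  proof -
    have "G \<noteq> {}"
      using subspace_0[OF G(1)] by blast
    then have "\<exists>y\<in>J ` G. y < m + inverse (real (Suc n))"
      unfolding m_def by (intro cInf_lessD) (auto simp del: of_nat_Suc)
    then show ?thesis by blast
  qed
  then obtain g where g: "\<And>n. g n \<in> G" "\<And>n. J (g n) < m + inverse (real (Suc n))"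
    by metis
  \<comment> \<open>Parallelogram identity for the energy product: the midpoint lies in
    \<open>G\<close>, so \<open>J\<close> is at least \<open>m\<close> there. Two almost minimal
    points are therefore close, and the minimising sequence is Cauchy.\<close>
  have para: "c * (norm (a - b))\<^sup>2 \<le> 2 * (J a - m) + 2 * (J b - m)" if "a \<in> G" "b \<in> G" for a b
  proof -
    have ba: "inner (S b) a = inner (S a) b"
      by (metis sym inner_commute)
    have "inner (S (a - b)) (a - b) = 2 * J a + 2 * J b - 4 * J ((1 / 2) *\<^sub>R (a + b))"
      unfolding J_def S.diff S.add S.scaleR
      by (simp add: inner_diff inner_add ba algebra_simps)
    moreover have "m \<le> J ((1 / 2) *\<^sub>R (a + b))"
      using that G(1) by (intro m subspace_scale subspace_add)
    ultimately show ?thesis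
      using coercive[of "a - b"] by simp
  qed
  have "Cauchy g"
  proof (rule metric_CauchyI)
    fix e :: real assume e: "e > 0"
    then have "c * e\<^sup>2 / 4 > 0"
      using c by simp
    then obtain M where M: "inverse (real (Suc M)) < c * e\<^sup>2 / 4"
      using reals_Archimedean by blast
    show "\<exists>M. \<forall>i\<ge>M. \<forall>j\<ge>M. dist (g i) (g j) < e"
    proof (intro exI allI impI)
      fix i j assume ij: "M \<le> i" "M \<le> j"
      have small: "J (g k) - m < c * e\<^sup>2 / 4" if "M \<le> k" for k
      proof -
        have "inverse (real (Suc k)) \<le> inverse (real (Suc M))"
          using that by (intro le_imp_inverse_le) auto
        then show ?thesis
          using g(2)[of k] M by linarith
      qed
      have "c * (norm (g i - g j))\<^sup>2 < c * e\<^sup>2"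
        using para[OF g(1)[of i] g(1)[of j]] small[OF ij(1)] small[OF ij(2)] by argo
      then have "(norm (g i - g j))\<^sup>2 < e\<^sup>2"
        using c by simp
      then show "dist (g i) (g j) < e"
        using e power_less_imp_less_base[of _ 2 e] by (simp add: dist_norm)
    qed
  qed
  then obtain h where h: "g \<longlonglongrightarrow> h"
    using Cauchy_convergent convergent_def by blast
  have hG: "h \<in> G"
    by (rule closed_sequentially[OF G(2) g(1) h])
  have "(\<lambda>n. J (g n)) \<longlonglongrightarrow> J h"
    unfolding J_def by (intro tendsto_intros h S.tendsto)
  moreover have "(\<lambda>n. m + inverse (real (Suc n))) \<longlonglongrightarrow> m + 0"
    by (intro tendsto_intros LIMSEQ_inverse_real_of_nat)
  ultimately have "J h \<le> m + 0"
    by (rule LIMSEQ_le) (use g(2) less_imp_le in blast)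
  then have Jh: "J h \<le> J x" if "x \<in> G" for x
    using m[OF that] by simp
  have "inner (S h) x = inner f x" if x: "x \<in> G" for x
  proof -
    define q where "q = inner (S x) x"
    define d where "d = inner (S h) x - inner f x"
    have q: "q \<ge> 0"
      using coercive[of x] c unfolding q_def by (smt (verit) mult_nonneg_nonneg zero_le_power2)
    \<comment> \<open>The exact minimiser of \<open>t * t * q + 2 * t * d\<close> is
      \<open>- d / q\<close>; the denominator \<open>q + 1\<close> covers \<open>q = 0\<close> and
      still gives a strict decrease unless \<open>d = 0\<close>.\<close>
    define t where "t = - d / (q + 1)"
    have xh: "inner (S x) h = inner (S h) x"
      by (metis sym inner_commute)
    have "J h \<le> J (h + t *\<^sub>R x)"
      using hG x G(1) by (intro Jh subspace_add subspace_scale)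
    also have "\<dots> = J h + (t\<^sup>2 * q + 2 * t * d)"
      unfolding J_def S.add S.scaleR
      by (simp add: inner_add q_def d_def xh power2_eq_square algebra_simps)
    finally have "0 \<le> (t\<^sup>2 * q + 2 * t * d) * (q + 1)\<^sup>2"
      by simp
    also have "\<dots> = (t * (q + 1))\<^sup>2 * q + 2 * (t * (q + 1)) * d * (q + 1)"
      by (simp add: power2_eq_square algebra_simps)
    also have "t * (q + 1) = - d"
      using q by (simp add: t_def)
    also have "(- d)\<^sup>2 * q + 2 * (- d) * d * (q + 1) = d\<^sup>2 * q - 2 * d\<^sup>2 * (q + 1)"
      by (simp add: power2_eq_square)
    also have "\<dots> = - (d\<^sup>2 * (q + 2))"
      by (simp add: algebra_simps)
    finally have "d\<^sup>2 * (q + 2) \<le> 0"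
      by simp
    then have "d = 0"
      using q by (simp add: mult_le_0_iff)
    then show ?thesis
      by (simp add: d_def)
  qed
  then show ?thesis
    using hG by blast
qed

section \<open>Complex inner products and operators\<close>

lemma cinner_add_right: "cinner x (y + z) = cinner x y + cinner (x::'a::chilbert_space) z"
  by (metis cinner_add_left cinner_commute complex_cnj_add)

lemma cinner_scaleC_right: "cinner x (a *\<^sub>C y) = cnj a * cinner (x::'a::chilbert_space) y"
  by (metis cinner_scaleC_left cinner_commute complex_cnj_mult)

text \<open>Rotating \<open>x\<close> by a unimodular scalar makes the product real and
  non-negative, so the real Cauchy-Schwarz inequality applies.\<close>

lemma norm_cinner_le: "norm (cinner x y) \<le> norm x * norm (y::'a::chilbert_space)"
proof (cases "cinner x y = 0")
  case False
  define a where "a = cnj (cinner x y) / norm (cinner x y)"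
  have a: "a * cinner x y = norm (cinner x y)" "cnj a * a = 1"
    using False complex_norm_square[of "cinner x y"]
    by (simp_all add: a_def field_simps power2_eq_square)
  have "cinner (a *\<^sub>C x) (a *\<^sub>C x) = cinner x x"
    using a(2) by (simp add: cinner_scaleC_left cinner_scaleC_right mult.assoc[symmetric] mult.commute)
  then have na: "norm (a *\<^sub>C x) = norm x"
    by (metis inner_eq_Re_cinner norm_eq_sqrt_inner)
  have "norm (cinner x y) = inner (a *\<^sub>C x) y"
    by (simp add: inner_eq_Re_cinner cinner_scaleC_left a(1))
  also have "\<dots> \<le> norm x * norm y"
    using norm_cauchy_schwarz[of "a *\<^sub>C x" y] na by simp
  finally show ?thesis .
qed simp

lemma Re_cinner_le: "Re (cinner x y) \<le> norm x * norm (y::'a::chilbert_space)"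
  by (metis inner_eq_Re_cinner norm_cauchy_schwarz)

lemma bounded_bilinear_cinner: "bounded_bilinear (cinner :: 'a::chilbert_space \<Rightarrow> 'a \<Rightarrow> complex)"
proof
  fix r and x y :: 'a
  show "cinner (r *\<^sub>R x) y = r *\<^sub>R cinner x y"
    by (metis cinner_scaleC_left scaleC_of_real scaleR_conv_of_real)
  show "cinner x (r *\<^sub>R y) = r *\<^sub>R cinner x y"
    by (metis cinner_scaleC_right complex_cnj_complex_of_real scaleC_of_real scaleR_conv_of_real)
next
  show "\<exists>K. \<forall>x y :: 'a. norm (cinner x y) \<le> norm x * norm y * K"
    by (intro exI[of _ 1]) (simp add: norm_cinner_le)
qed (simp_all add: cinner_add_left cinner_add_right)

interpretation cinner: bounded_bilinear "cinner :: 'a::chilbert_space \<Rightarrow> 'a \<Rightarrow> complex"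
  by (rule bounded_bilinear_cinner)

lemma norm_scaleC: "norm (a *\<^sub>C x) = norm a * norm (x::'a::chilbert_space)"
proof -
  have "cinner (a *\<^sub>C x) (a *\<^sub>C x) = of_real ((norm a)\<^sup>2) * cinner x x"
    by (simp only: cinner_scaleC_left cinner_scaleC_right complex_norm_square mult_ac)
  then have "complex_of_real ((norm (a *\<^sub>C x))\<^sup>2) = of_real ((norm a * norm x)\<^sup>2)"
    by (simp only: cinner_self power_mult_distrib of_real_mult)
  then have "(norm (a *\<^sub>C x))\<^sup>2 = (norm a * norm x)\<^sup>2"
    by (simp only: of_real_eq_iff)
  then show ?thesis
    by simp
qed

lemma bounded_linear_scaleC: "bounded_linear ((*\<^sub>C) a :: 'a::chilbert_space \<Rightarrow> 'a)"
proof (rule bounded_linear_intro)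
  show "a *\<^sub>C (r *\<^sub>R x) = r *\<^sub>R (a *\<^sub>C x)" for r and x :: 'a
    by (metis scaleC_of_real scaleC_scaleC mult.commute)
  show "norm (a *\<^sub>C x) \<le> norm x * norm a" for x :: 'a
    by (simp add: norm_scaleC mult.commute)
qed (simp add: scaleC_add_right)

lemmas tendsto_scaleC = bounded_linear_scaleC[THEN bounded_linear.tendsto]

lemma csubspace_imp_subspace: "csubspace S \<Longrightarrow> subspace S"
  unfolding csubspace_def subspace_def by (metis scaleC_of_real)

lemma csubspace_0: "csubspace S \<Longrightarrow> 0 \<in> S"
  and csubspace_add: "csubspace S \<Longrightarrow> x \<in> S \<Longrightarrow> y \<in> S \<Longrightarrow> x + y \<in> S"
  and csubspace_scaleC: "csubspace S \<Longrightarrow> x \<in> S \<Longrightarrow> a *\<^sub>C x \<in> S"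
  by (auto simp: csubspace_def)

lemma csubspace_diff: "csubspace S \<Longrightarrow> x \<in> S \<Longrightarrow> y \<in> S \<Longrightarrow> x - y \<in> S"
  by (meson csubspace_imp_subspace subspace_diff)

lemma csubspace_closure:
  assumes "csubspace S"
  shows "csubspace (closure S)"
  unfolding csubspace_def
proof (intro conjI ballI allI)
  show "0 \<in> closure S"
    using csubspace_0[OF assms] closure_subset by blast
next
  fix x y assume "x \<in> closure S" "y \<in> closure S"
  then obtain s t where "\<And>n. s n \<in> S" "s \<longlonglongrightarrow> x" "\<And>n. t n \<in> S" "t \<longlonglongrightarrow> y"
    unfolding closure_sequential by blast
  then have "\<And>n. s n + t n \<in> S" "(\<lambda>n. s n + t n) \<longlonglongrightarrow> x + y"
    using assms by (auto intro: csubspace_add tendsto_add)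
  then show "x + y \<in> closure S"
    unfolding closure_sequential by (intro exI[of _ "\<lambda>n. s n + t n"]) simp
next
  fix a x assume "x \<in> closure S"
  then obtain s where "\<And>n. s n \<in> S" "s \<longlonglongrightarrow> x"
    unfolding closure_sequential by blast
  then have "\<And>n. a *\<^sub>C s n \<in> S" "(\<lambda>n. a *\<^sub>C s n) \<longlonglongrightarrow> a *\<^sub>C x"
    using assms by (auto intro: csubspace_scaleC tendsto_scaleC)
  then show "a *\<^sub>C x \<in> closure S"
    unfolding closure_sequential by (intro exI[of _ "\<lambda>n. a *\<^sub>C s n"]) simp
qed

lemma csubspace_Domain: "csubspace R \<Longrightarrow> csubspace (Domain R)"
  and csubspace_Range: "csubspace R \<Longrightarrow> csubspace (Range R)"
  unfolding csubspace_def Domain.simps Range.simps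
  by (auto simp: zero_prod_def plus_prod_def scaleC_prod_def Ball_def; metis)+

text \<open>The real product with \<open>\<i> *\<^sub>C x\<close> is the imaginary part of the
  complex product with \<open>x\<close>, so closure of \<open>G\<close> under complex scalars
  upgrades a real identity to a complex one.\<close>

lemma cinner_eq_if_inner_eq:
  assumes "csubspace G" and eq: "\<And>x. x \<in> G \<Longrightarrow> inner y x = inner z x" and x: "x \<in> G"
  shows "cinner y x = cinner z x"
proof (rule complex_eqI)
  show "Re (cinner y x) = Re (cinner z x)"
    using eq[OF x] by (simp add: inner_eq_Re_cinner)
  show "Im (cinner y x) = Im (cinner z x)"
    using eq[OF csubspace_scaleC[OF assms(1) x], of \<i>]
    by (simp add: inner_eq_Re_cinner cinner_scaleC_right)
qed

lemma hermitian_coercive_solution: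
  fixes S :: "'a::chilbert_space \<Rightarrow> 'a"
  assumes "bounded_linear S" and "\<And>x y. cinner (S x) y = cinner x (S y)"
    and "c > 0" and "\<And>x. c * (norm x)\<^sup>2 \<le> Re (cinner (S x) x)"
    and G: "csubspace G" "closed G"
  shows "\<exists>g\<in>G. \<forall>x\<in>G. cinner (S g) x = cinner f x"
proof -
  have "\<exists>g\<in>G. \<forall>x\<in>G. inner (S g) x = inner f x"
    by (rule symmetric_coercive_solution[where c = c])
      (use assms in \<open>auto simp: inner_eq_Re_cinner csubspace_imp_subspace\<close>)
  then show ?thesis
    using cinner_eq_if_inner_eq[OF G(1)] by metis
qed

lemma eq_zero_if_orthogonal_dense:
  assumes "closure D = UNIV" and "\<And>x. x \<in> D \<Longrightarrow> cinner x z = 0"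
  shows "z = (0::'a::chilbert_space)"
proof -
  obtain s where s: "\<And>n. s n \<in> D" "s \<longlonglongrightarrow> z"
    using assms(1) unfolding closure_sequential[symmetric] by (metis UNIV_I closure_sequential)
  have "(\<lambda>n. cinner (s n) z) \<longlonglongrightarrow> cinner z z"
    by (intro cinner.tendsto s tendsto_const)
  then have "cinner z z = 0"
    using assms(2)[OF s(1)] by (simp add: LIMSEQ_const_iff)
  then show ?thesis by (simp add: cinner_self)
qed

lemma cinner_eq_iff: "(\<forall>z. cinner z x = cinner z y) \<longleftrightarrow> x = (y::'a::chilbert_space)"
  using eq_zero_if_orthogonal_dense[of UNIV "x - y"] by (auto simp: cinner.diff_right)

lemma cinner_limit_eq:
  fixes s t s' t' :: "nat \<Rightarrow> 'a::chilbert_space"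
  assumes "\<And>n. cinner (s n) (t n) = cinner (s' n) (t' n)"
    and "s \<longlonglongrightarrow> x" "t \<longlonglongrightarrow> y" "s' \<longlonglongrightarrow> x'" "t' \<longlonglongrightarrow> y'"
  shows "cinner x y = cinner x' y'"
  using LIMSEQ_unique[OF cinner.tendsto[OF assms(2,3)]] cinner.tendsto[OF assms(4,5)] assms(1)
  by simp

section \<open>Operators as graphs: application, adjoints, closedness\<close>

lemma in_linear_op: "linear_op T \<Longrightarrow> x \<in> Domain T \<Longrightarrow> (x, app T x) \<in> T"
  by (auto simp: linear_op_def app_eq)

lemma linear_op_app_eq: "linear_op T \<Longrightarrow> (x, y) \<in> T \<Longrightarrow> app T x = y"
  by (auto simp: linear_op_def app_eq)

lemma csubspace_Domain_op: "linear_op T \<Longrightarrow> csubspace (Domain T)"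
  by (simp add: linear_op_def csubspace_Domain)

lemma app_add:
  assumes "linear_op T" "x \<in> Domain T" "y \<in> Domain T"
  shows "app T (x + y) = app T x + app T y"
  using csubspace_add[of T "(x, app T x)" "(y, app T y)"] assms
  by (auto simp: linear_op_app_eq in_linear_op linear_op_def)

lemma app_scaleC:
  assumes "linear_op T" "x \<in> Domain T"
  shows "app T (a *\<^sub>C x) = a *\<^sub>C app T x"
  using csubspace_scaleC[of T "(x, app T x)" a] assms
  by (auto simp: linear_op_app_eq in_linear_op linear_op_def scaleC_prod_def)

lemma app_diff:
  assumes "linear_op T" "x \<in> Domain T" "y \<in> Domain T"
  shows "app T (x - y) = app T x - app T y"
  using csubspace_diff[of T "(x, app T x)" "(y, app T y)"] assms
  by (auto simp: linear_op_app_eq in_linear_op linear_op_def)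

lemma csubspace_adjoint_op: "csubspace (adjoint_op A)"
  unfolding csubspace_def adjoint_op_def
  by (auto simp: zero_prod_def scaleC_prod_def cinner.add_right cinner.zero_right
      cinner_scaleC_right split: prod.splits)

lemma closed_adjoint_op: "closed (adjoint_op A)"
proof -
  have "adjoint_op A = (\<Inter>p\<in>A. {q. cinner (snd p) (fst q) = cinner (fst p) (snd q)})"
    by (fastforce simp: adjoint_op_def)
  moreover have "closed {q. cinner z (fst q) = cinner u (snd q)}" for u z :: 'a
    by (intro closed_Collect_eq cinner.continuous_on continuous_intros)
  ultimately show ?thesis
    by auto
qed

lemma closed_if_bounded:
  assumes U: "linear_op U" and clo: "closed (Domain U)"
    and bound: "\<And>x. x \<in> Domain U \<Longrightarrow> norm (app U x) \<le> C * norm x"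
  shows "closed (U :: 'a::chilbert_space operator)"
  unfolding closed_sequential_limits
proof (intro allI impI)
  fix s p assume s: "(\<forall>n. s n \<in> U) \<and> s \<longlonglongrightarrow> p"
  have mem: "fst (s n) \<in> Domain U" "app U (fst (s n)) = snd (s n)" for n
    using s linear_op_app_eq[OF U, of "fst (s n)" "snd (s n)"] by (auto simp: Domain_fst)
  have lim: "(\<lambda>n. fst (s n)) \<longlonglongrightarrow> fst p" "(\<lambda>n. snd (s n)) \<longlonglongrightarrow> snd p"
    using s by (auto intro: tendsto_fst tendsto_snd)
  have p: "fst p \<in> Domain U"
    using closed_sequentially[OF clo mem(1) lim(1)] .
  have le: "norm (snd (s n) - app U (fst p)) \<le> C * norm (fst (s n) - fst p)" for n
    using bound[OF csubspace_diff[OF csubspace_Domain_op[OF U] mem(1)[of n] p]]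
      app_diff[OF U mem(1)[of n] p] mem(2)[of n] by simp
  have lim0: "(\<lambda>n. C * norm (fst (s n) - fst p)) \<longlonglongrightarrow> 0"
    using lim(1) by (intro tendsto_mult_right_zero tendsto_norm_zero LIM_zero)
  have "(\<lambda>n. snd (s n) - app U (fst p)) \<longlonglongrightarrow> 0"
    by (rule Lim_null_comparison[OF always_eventually[OF allI[OF le]] lim0])
  then have "snd p = app U (fst p)"
    by (rule LIMSEQ_unique[OF lim(2) LIM_zero_cancel])
  then show "p \<in> U"
    using in_linear_op[OF U p] by (metis prod.collapse)
qed

text \<open>The bound turns convergent arguments into Cauchy values, and the closed graph keeps the
  limiting pair. The form for linear relations also fits the converse of \<open>U\<close>, where it
  yields a closed range.\<close>

lemma closed_Domain_if_bounded:
  assumes R: "csubspace R" "closed (R :: 'a::chilbert_space operator)"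
    and bound: "\<And>x y. (x, y) \<in> R \<Longrightarrow> norm y \<le> C * norm x"
  shows "closed (Domain R)"
  unfolding closed_sequential_limits
proof (intro allI impI)
  fix s x assume s: "(\<forall>n. s n \<in> Domain R) \<and> s \<longlonglongrightarrow> x"
  then have "\<forall>n. \<exists>y. (s n, y) \<in> R"
    by blast
  then obtain y where y: "\<And>n. (s n, y n) \<in> R"
    by metis
  \<comment> \<open>Nothing is known about the sign of \<open>C\<close>;
    \<open>\<bar>C\<bar> + 1\<close> is a safe positive divisor.\<close>
  have C1: "\<bar>C\<bar> + 1 > 0" by simp
  have "Cauchy y"
  proof (rule metric_CauchyI)
    fix e :: real assume "e > 0"
    then have "e / (\<bar>C\<bar> + 1) > 0"
      using C1 by simp
    then obtain N where N: "\<And>m n. m \<ge> N \<Longrightarrow> n \<ge> N \<Longrightarrow> dist (s m) (s n) < e / (\<bar>C\<bar> + 1)"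
      using s metric_CauchyD[OF LIMSEQ_imp_Cauchy] by metis
    show "\<exists>N. \<forall>m\<ge>N. \<forall>n\<ge>N. dist (y m) (y n) < e"
    proof (intro exI allI impI)
      fix m n assume mn: "m \<ge> N" "n \<ge> N"
      have "dist (y m) (y n) \<le> C * dist (s m) (s n)"
        using csubspace_diff[OF R(1) y[of m] y[of n]] bound by (simp add: dist_norm)
      also have "\<dots> \<le> (\<bar>C\<bar> + 1) * dist (s m) (s n)"
        by (intro mult_right_mono) auto
      also have "\<dots> < e"
        using N[OF mn] C1 by (simp add: field_simps)
      finally show "dist (y m) (y n) < e" .
    qed
  qed
  then obtain z where "y \<longlonglongrightarrow> z"
    using Cauchy_convergent convergent_def by blast
  then have "(x, z) \<in> R"
    using closed_sequentially[OF R(2), of "\<lambda>n. (s n, y n)"] y s by (simp add: tendsto_Pair)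
  then show "x \<in> Domain R" by blast
qed

lemma csubspace_converse:
  assumes R: "csubspace (R :: 'a::chilbert_space operator)"
  shows "csubspace (R\<inverse>)"
  unfolding csubspace_def
proof (intro conjI ballI allI)
  show "0 \<in> R\<inverse>"
    using csubspace_0[OF R] by (simp add: zero_prod_def)
  show "p + q \<in> R\<inverse>" if "p \<in> R\<inverse>" "q \<in> R\<inverse>" for p q
    using that csubspace_add[OF R, of "(snd p, fst p)" "(snd q, fst q)"] by (cases p; cases q) simp
  show "a *\<^sub>C p \<in> R\<inverse>" if "p \<in> R\<inverse>" for a p
    using that csubspace_scaleC[OF R, of "(snd p, fst p)" a] by (cases p) (simp add: scaleC_prod_def)
qed

lemma linear_op_ball_iff:
  "linear_op U \<Longrightarrow> (\<forall>x\<in>Domain U. P x (app U x)) \<longleftrightarrow> (\<forall>(x, y)\<in>U. P x y)"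
  using in_linear_op linear_op_app_eq by fastforce

section \<open>The boundary form of a joint pair\<close>

text \<open>The objects of the theorem are parameters tied down by equations, so the results below
  speak about its symbols literally and are obtained by interpretation from its assumptions.\<close>

locale friedrichs_pair =
  fixes T0 Tt0 T1 Tt1 :: "'h::chilbert_space operator"
    and W0 W K Kt :: "'h set"
    and form :: "'h \<Rightarrow> 'h \<Rightarrow> complex"
  assumes pair: "joint_friedrichs_pair T0 Tt0"
    and T1: "T1 = adjoint_op Tt0" and Tt1: "Tt1 = adjoint_op T0"
    and W0: "W0 = Domain (closure T0)" and W: "W = Domain T1"
    and K: "K = ker T1" and Kt: "Kt = ker Tt1"
    and form: "form = boundary_form T1 Tt1"
begin

abbreviation "D \<equiv> Domain T0"

lemma linear_T0: "linear_op T0" "linear_op Tt0"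
  and Domain_Tt0: "Domain Tt0 = D"
  and dense_D: "closure D = UNIV"
  and T0_Tt0: "\<phi> \<in> D \<Longrightarrow> \<psi> \<in> D \<Longrightarrow> cinner (app T0 \<phi>) \<psi> = cinner \<phi> (app Tt0 \<psi>)"
  using pair unfolding joint_friedrichs_pair_def by auto

lemma csubspace_D: "csubspace D"
  by (rule csubspace_Domain_op[OF linear_T0(1)])

section \<open>The bounded hermitian extension of the sum of the two operators\<close>

definition A0 :: "'h \<Rightarrow> 'h"
  where "A0 \<phi> = app T0 \<phi> + app Tt0 \<phi>"

lemma A0_diff: "x \<in> D \<Longrightarrow> y \<in> D \<Longrightarrow> A0 (x - y) = A0 x - A0 y"
  by (auto simp: A0_def app_diff linear_T0 Domain_Tt0)

lemma A0_hermitian: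
  assumes "x \<in> D" "y \<in> D"
  shows "cinner (A0 x) y = cinner x (A0 y)"
  using T0_Tt0[OF assms] T0_Tt0[OF assms(2,1)] cinner_commute[of "app Tt0 x" y]
    cinner_commute[of x "app T0 y"]
  by (simp add: A0_def cinner.add_left cinner.add_right)

text \<open>Extension by continuity as a relation: this postpones the choice of an approximating
  sequence until uniqueness of the value is available.\<close>

definition A0_limit :: "'h \<Rightarrow> 'h \<Rightarrow> bool"
  where "A0_limit v z \<longleftrightarrow> (\<exists>s. (\<forall>n. s n \<in> D) \<and> s \<longlonglongrightarrow> v \<and> (\<lambda>n. A0 (s n)) \<longlonglongrightarrow> z)"

lemma A0_limit_ex: "\<exists>z. A0_limit v z"
proof -
  obtain l where l: "l > 0" "\<And>x. x \<in> D \<Longrightarrow> norm (A0 x) \<le> 2 * l * norm x"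
    using pair unfolding joint_friedrichs_pair_def A0_def by blast
  obtain s where s: "\<And>n. s n \<in> D" "s \<longlonglongrightarrow> v"
    using dense_D closure_sequential[of v D] by auto
  have "Cauchy (\<lambda>n. A0 (s n))"
  proof (rule metric_CauchyI)
    fix e :: real assume "e > 0"
    then have "e / (2 * l) > 0"
      using l by simp
    then obtain N where N: "\<And>m n. m \<ge> N \<Longrightarrow> n \<ge> N \<Longrightarrow> dist (s m) (s n) < e / (2 * l)"
      using metric_CauchyD[OF LIMSEQ_imp_Cauchy[OF s(2)]] by blast
    show "\<exists>N. \<forall>m\<ge>N. \<forall>n\<ge>N. dist (A0 (s m)) (A0 (s n)) < e"
    proof (intro exI allI impI)
      fix m n assume mn: "m \<ge> N" "n \<ge> N"
      have "dist (A0 (s m)) (A0 (s n)) \<le> 2 * l * dist (s m) (s n)"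
        using l(2)[OF csubspace_diff[OF csubspace_D s(1)[of m] s(1)[of n]]] s(1)
        by (simp add: dist_norm A0_diff)
      also have "\<dots> < e"
        using N[OF mn] l(1) by (simp add: field_simps)
      finally show "dist (A0 (s m)) (A0 (s n)) < e" .
    qed
  qed
  then show ?thesis
    using s unfolding A0_limit_def by (metis Cauchy_convergent convergent_def)
qed

lemma A0_limit_hermitian:
  assumes "A0_limit x z" "A0_limit y w"
  shows "cinner z y = cinner x w"
proof -
  obtain s t where s: "\<And>n. s n \<in> D" "s \<longlonglongrightarrow> x" "(\<lambda>n. A0 (s n)) \<longlonglongrightarrow> z"
    and t: "\<And>n. t n \<in> D" "t \<longlonglongrightarrow> y" "(\<lambda>n. A0 (t n)) \<longlonglongrightarrow> w"
    using assms unfolding A0_limit_def by metis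
  show ?thesis
    by (rule cinner_limit_eq[OF A0_hermitian[OF s(1) t(1)] s(3) t(2) s(2) t(3)])
qed

lemma A0_limit_D: "x \<in> D \<Longrightarrow> A0_limit x (A0 x)"
  unfolding A0_limit_def by (intro exI[of _ "\<lambda>_. x"]) auto

text \<open>Hermitian symmetry fixes the products of \<open>z\<close> with all vectors of the dense
  set \<open>D\<close>, hence \<open>z\<close> itself; approximating sequences are never
  compared.\<close>

lemma A0_limit_unique: "A0_limit x z \<Longrightarrow> A0_limit x z' \<Longrightarrow> z = z'"
  using eq_zero_if_orthogonal_dense[OF dense_D, of "z - z'"]
    A0_limit_hermitian[OF A0_limit_D, of _ x z] A0_limit_hermitian[OF A0_limit_D, of _ x z']
  by (simp add: cinner.diff_right)

definition S :: "'h \<Rightarrow> 'h"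
  where "S x = (SOME z. A0_limit x z)"

lemma A0_limit_S: "A0_limit x (S x)"
  unfolding S_def by (rule someI_ex[OF A0_limit_ex])

lemma S_D: "x \<in> D \<Longrightarrow> S x = app T0 x + app Tt0 x"
  using A0_limit_unique[OF A0_limit_S A0_limit_D] by (simp add: A0_def)

lemma S_hermitian: "cinner (S x) y = cinner x (S y)"
  by (rule A0_limit_hermitian[OF A0_limit_S A0_limit_S])

text \<open>Symmetry moves \<open>S\<close> to the other entry, so linearity of \<open>S\<close> is
  inherited from the scalar product. Additivity is obtained in the same way.\<close>

lemma S_scaleC: "S (a *\<^sub>C x) = a *\<^sub>C S x"
proof -
  have "cinner z (S (a *\<^sub>C x)) = cinner z (a *\<^sub>C S x)" for z
    by (simp add: S_hermitian[symmetric] cinner_scaleC_right)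
  then show ?thesis
    using cinner_eq_iff by blast
qed

lemma S_coercive: "\<exists>c>0. \<forall>x. c * (norm x)\<^sup>2 \<le> Re (cinner (S x) x)"
proof -
  obtain \<mu> where \<mu>: "\<mu> > 0"
      "\<And>x. x \<in> D \<Longrightarrow> cinner (A0 x) x \<ge> complex_of_real (2 * \<mu> * (norm x)\<^sup>2)"
    using pair unfolding joint_friedrichs_pair_def A0_def by blast
  have "2 * \<mu> * (norm x)\<^sup>2 \<le> Re (cinner (S x) x)" for x
  proof -
    obtain s where s: "\<And>n. s n \<in> D" "s \<longlonglongrightarrow> x" "(\<lambda>n. A0 (s n)) \<longlonglongrightarrow> S x"
      using A0_limit_S[of x] unfolding A0_limit_def by blast
    have "(\<lambda>n. 2 * \<mu> * (norm (s n))\<^sup>2) \<longlonglongrightarrow> 2 * \<mu> * (norm x)\<^sup>2"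
      by (intro tendsto_intros s)
    moreover have "(\<lambda>n. Re (cinner (A0 (s n)) (s n))) \<longlonglongrightarrow> Re (cinner (S x) x)"
      by (intro tendsto_intros cinner.tendsto s)
    moreover have "2 * \<mu> * (norm (s n))\<^sup>2 \<le> Re (cinner (A0 (s n)) (s n))" for n
      using \<mu>(2)[OF s(1)[of n]] by (simp add: less_eq_complex_def)
    ultimately show ?thesis
      by (intro LIMSEQ_le) auto
  qed
  then show ?thesis
    using \<mu>(1) by (intro exI[of _ "2 * \<mu>"]) auto
qed

lemma bounded_linear_S: "bounded_linear S"
proof -
  have add: "S (x + y) = S x + S y" for x y
    using cinner_eq_iff[of "S (x + y)" "S x + S y"]
    by (simp add: S_hermitian[symmetric] cinner.add_right)
  obtain l where l: "\<And>x. x \<in> D \<Longrightarrow> norm (A0 x) \<le> 2 * l * norm x"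
    using pair unfolding joint_friedrichs_pair_def A0_def by blast
  have "norm (S x) \<le> norm x * (2 * l)" for x
  proof -
    obtain s where s: "\<And>n. s n \<in> D" "s \<longlonglongrightarrow> x" "(\<lambda>n. A0 (s n)) \<longlonglongrightarrow> S x"
      using A0_limit_S[of x] unfolding A0_limit_def by blast
    have "(\<lambda>n. 2 * l * norm (s n)) \<longlonglongrightarrow> 2 * l * norm x"
      by (intro tendsto_intros s)
    then have "norm (S x) \<le> 2 * l * norm x"
      by (rule LIMSEQ_le[OF tendsto_norm[OF s(3)]]) (use l s(1) in auto)
    then show ?thesis by (simp add: mult_ac)
  qed
  then show ?thesis
    using add S_scaleC[of "of_real _"] by (intro bounded_linear_intro) (auto simp: scaleC_of_real)
qed

sublocale S: bounded_linear S
  by (rule bounded_linear_S)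

section \<open>The maximal operators and the boundary form\<close>

lemma T1_iff: "(v, w) \<in> T1 \<longleftrightarrow> (\<forall>\<phi>\<in>D. cinner (app Tt0 \<phi>) v = cinner \<phi> w)"
  and Tt1_iff: "(v, w) \<in> Tt1 \<longleftrightarrow> (\<forall>\<phi>\<in>D. cinner (app T0 \<phi>) v = cinner \<phi> w)"
  using in_linear_op[OF linear_T0(1)] in_linear_op[OF linear_T0(2)]
    linear_op_app_eq[OF linear_T0(1)] linear_op_app_eq[OF linear_T0(2)] Domain_Tt0
  by (fastforce simp: T1 Tt1 adjoint_op_def)+

text \<open>On \<open>D\<close> the two operators add up to \<open>S\<close>, so for fixed
  \<open>v\<close> the left sides of the two adjoint identities add up to
  \<open>cinner \<phi> (S v)\<close>. In effect the second maximal operator is \<open>S\<close>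
  minus the first, with the same domain, and later arguments can be phrased by \<open>T1\<close>
  alone.\<close>

lemma Tt1_iff_T1: "(v, w) \<in> Tt1 \<longleftrightarrow> (v, S v - w) \<in> T1"
proof -
  have "cinner (app T0 \<phi>) v = cinner \<phi> w \<longleftrightarrow> cinner (app Tt0 \<phi>) v = cinner \<phi> (S v - w)"
    if "\<phi> \<in> D" for \<phi>
  proof -
    have "cinner (app T0 \<phi>) v + cinner (app Tt0 \<phi>) v = cinner \<phi> (S v)"
      using S_hermitian[of \<phi> v] S_D[OF that] by (simp add: cinner.add_left)
    then show ?thesis
      by (auto simp: cinner.diff_right dest: sym)
  qed
  then show ?thesis
    by (simp add: T1_iff Tt1_iff)
qed

lemma linear_T1: "linear_op T1"
proof -
  have "single_valued T1"
    unfolding single_valued_def T1_iff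
    using eq_zero_if_orthogonal_dense[OF dense_D]
    by (metis cinner.diff_right eq_iff_diff_eq_0)
  then show ?thesis
    by (simp add: linear_op_def T1 csubspace_adjoint_op)
qed

lemma closed_T1: "closed T1"
  by (simp add: T1 closed_adjoint_op)

definition L :: "'h \<Rightarrow> 'h"
  where "L = app T1"

lemma L_in: "u \<in> W \<Longrightarrow> (u, L u) \<in> T1"
  by (simp add: L_def W in_linear_op linear_T1)

lemma L_eq: "(u, y) \<in> T1 \<Longrightarrow> L u = y"
  by (simp add: L_def linear_op_app_eq linear_T1)

lemma T1_W: "(u, y) \<in> T1 \<Longrightarrow> u \<in> W"
  by (auto simp: W)

lemma csubspace_W: "csubspace W"
  unfolding W by (rule csubspace_Domain_op[OF linear_T1])

lemma L_add: "u \<in> W \<Longrightarrow> v \<in> W \<Longrightarrow> L (u + v) = L u + L v"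
  and L_diff: "u \<in> W \<Longrightarrow> v \<in> W \<Longrightarrow> L (u - v) = L u - L v"
  and L_scaleC: "u \<in> W \<Longrightarrow> L (a *\<^sub>C u) = a *\<^sub>C L u"
  by (auto simp: L_def W app_add app_diff app_scaleC linear_T1)

lemma L_0: "L 0 = 0"
  using L_diff[OF csubspace_0 csubspace_0, OF csubspace_W csubspace_W] by simp

lemma app_Tt1: "u \<in> W \<Longrightarrow> app Tt1 u = S u - L u"
proof (rule app_eq)
  show "single_valued Tt1"
    using linear_T1 unfolding linear_op_def single_valued_def Tt1_iff_T1
    by (metis diff_diff_eq2 add_diff_cancel_left' diff_add_cancel)
qed (simp add: Tt1_iff_T1 L_in)

lemma form_eq: "v \<in> W \<Longrightarrow> form u v = cinner (L u) v - cinner u (S v - L v)"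
  by (simp add: form boundary_form_def app_Tt1 L_def)

lemma form_commute: "u \<in> W \<Longrightarrow> v \<in> W \<Longrightarrow> form v u = cnj (form u v)"
  using S_hermitian[of u v] cinner_commute[of v "L u"] cinner_commute[of u "L v"]
    cinner_commute[of v "S u"]
  by (simp add: form_eq cinner.diff_right)

lemma form_add_left: "u \<in> W \<Longrightarrow> v \<in> W \<Longrightarrow> w \<in> W \<Longrightarrow> form (u + v) w = form u w + form v w"
  and form_add_right: "u \<in> W \<Longrightarrow> v \<in> W \<Longrightarrow> w \<in> W \<Longrightarrow> form w (u + v) = form w u + form w v"
  and form_scaleC_right: "u \<in> W \<Longrightarrow> w \<in> W \<Longrightarrow> form w (a *\<^sub>C u) = cnj a * form w u"
  by (simp_all add: form_eq L_add L_scaleC csubspace_add csubspace_scaleC csubspace_W S.add S_scaleC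
      cinner.add_left cinner.add_right cinner.diff_left cinner.diff_right cinner_scaleC_left
      cinner_scaleC_right right_diff_distrib)

lemma form_diff_left: "u \<in> W \<Longrightarrow> v \<in> W \<Longrightarrow> w \<in> W \<Longrightarrow> form (u - v) w = form u w - form v w"
  using form_add_left[of "u - v" v w] csubspace_diff[OF csubspace_W] by simp

lemma form_diff_right: "u \<in> W \<Longrightarrow> v \<in> W \<Longrightarrow> w \<in> W \<Longrightarrow> form w (u - v) = form w u - form w v"
  using form_add_right[of "u - v" v w] csubspace_diff[OF csubspace_W] by simp

lemma form_self_real: "u \<in> W \<Longrightarrow> Im (form u u) = 0"
  using form_commute[of u u] by (simp add: complex_eq_iff)

lemma in_nonneg_cone: "u \<in> nonneg_cone W form \<longleftrightarrow> u \<in> W \<and> 0 \<le> Re (form u u)"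
  and in_nonpos_cone: "u \<in> nonpos_cone W form \<longleftrightarrow> u \<in> W \<and> Re (form u u) \<le> 0"
  by (auto simp: nonneg_cone_def nonpos_cone_def less_eq_complex_def form_self_real)

lemma T0_subset_T1: "T0 \<subseteq> T1"
proof
  fix p assume p: "p \<in> T0"
  obtain \<phi> z where pz: "p = (\<phi>, z)" by fastforce
  then have \<phi>: "\<phi> \<in> D" "z = app T0 \<phi>"
    using p by (auto simp: linear_op_app_eq linear_T0)
  have "cinner (app Tt0 \<psi>) \<phi> = cinner \<psi> z" if "\<psi> \<in> D" for \<psi>
    using T0_Tt0[OF \<phi>(1) that] \<phi>(2) cinner_commute[of \<psi>] cinner_commute[of _ \<phi>] by metis
  then show "p \<in> T1"
    by (simp add: pz T1_iff)
qed

lemma closure_T0: "closure T0 \<subseteq> T1"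
  by (rule closure_minimal[OF T0_subset_T1 closed_T1])

lemma W0_iff: "u \<in> W0 \<longleftrightarrow> (u, L u) \<in> closure T0"
  using closure_T0 L_eq unfolding W0 by blast

lemma W0_W: "u \<in> W0 \<Longrightarrow> u \<in> W"
  using closure_T0 by (auto simp: W0 W)

lemma csubspace_W0: "csubspace W0"
  unfolding W0 using linear_T0(1)
  by (intro csubspace_Domain csubspace_closure) (auto simp: linear_op_def)

lemma W0_limit:
  assumes "\<And>n. s n \<in> W0" "s \<longlonglongrightarrow> u" "(\<lambda>n. L (s n)) \<longlonglongrightarrow> w"
  shows "u \<in> W0" "L u = w"
proof -
  have "(u, w) \<in> closure T0"
    by (rule closed_sequentially[OF closed_closure, of "\<lambda>n. (s n, L (s n))"])
      (use assms in \<open>auto simp: W0_iff intro: tendsto_Pair\<close>)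
  then show "u \<in> W0" "L u = w"
    using closure_T0 L_eq W0 by blast+
qed

lemma W_limit:
  assumes "\<And>n. s n \<in> W" "s \<longlonglongrightarrow> u" "(\<lambda>n. L (s n)) \<longlonglongrightarrow> w"
  shows "u \<in> W" "L u = w"
proof -
  have "(u, w) \<in> T1"
    by (rule closed_sequentially[OF closed_T1, of "\<lambda>n. (s n, L (s n))"])
      (use assms in \<open>auto simp: L_in intro: tendsto_Pair\<close>)
  then show "u \<in> W" "L u = w"
    using T1_W L_eq by blast+
qed

text \<open>On the graph of \<open>T0\<close> this is the defining relation of the adjoint. For
  fixed \<open>v\<close> it is a closed condition on pairs, so it passes to
  \<open>closure T0\<close>.\<close>

lemma form_W0_left:
  assumes u: "u \<in> W0" and v: "v \<in> W"
  shows "form u v = 0"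
proof -
  have "closed {p. cinner (snd p) v = cinner (fst p) (S v - L v)}"
    by (intro closed_Collect_eq cinner.continuous_on continuous_intros)
  moreover have "(v, S v - L v) \<in> Tt1"
    using v by (simp add: Tt1_iff_T1 L_in)
  then have "T0 \<subseteq> {p. cinner (snd p) v = cinner (fst p) (S v - L v)}"
    by (auto simp: Tt1 adjoint_op_def)
  ultimately have "closure T0 \<subseteq> {p. cinner (snd p) v = cinner (fst p) (S v - L v)}"
    by (rule closure_minimal[rotated])
  then show ?thesis
    using u v by (auto simp: W0_iff form_eq)
qed

lemma form_W0_right: "u \<in> W0 \<Longrightarrow> v \<in> W \<Longrightarrow> form v u = 0"
  using form_commute[OF W0_W] form_W0_left by simp

section \<open>The two kernels and the form on them\<close>

lemma K_iff: "x \<in> K \<longleftrightarrow> x \<in> W \<and> L x = 0"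
  using T1_W L_eq L_in by (auto simp: K ker_def) metis

lemma Kt_iff: "x \<in> Kt \<longleftrightarrow> x \<in> W \<and> L x = S x"
  using T1_W L_eq L_in by (auto simp: Kt ker_def Tt1_iff_T1) metis

lemma K_W: "x \<in> K \<Longrightarrow> x \<in> W" and K_L: "x \<in> K \<Longrightarrow> L x = 0"
  and Kt_W: "x \<in> Kt \<Longrightarrow> x \<in> W" and Kt_L: "x \<in> Kt \<Longrightarrow> L x = S x"
  by (auto simp: K_iff Kt_iff)

lemma csubspace_K: "csubspace K" and csubspace_Kt: "csubspace Kt"
  using csubspace_W L_0
  by (auto simp: csubspace_def K_iff Kt_iff L_add L_scaleC S_scaleC S.add S.zero
      bounded_linear_scaleC[THEN linear_simps(3)])

lemma closed_K: "closed K"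
  unfolding closed_sequential_limits
proof (intro allI impI)
  fix s l assume s: "(\<forall>n. s n \<in> K) \<and> s \<longlonglongrightarrow> l"
  then have "(\<lambda>n. L (s n)) \<longlonglongrightarrow> 0"
    by (simp add: K_L)
  then show "l \<in> K"
    using W_limit[of s l 0] s by (simp add: K_iff)
qed

lemma closed_Kt: "closed Kt"
  unfolding closed_sequential_limits
proof (intro allI impI)
  fix s l assume s: "(\<forall>n. s n \<in> Kt) \<and> s \<longlonglongrightarrow> l"
  then have "(\<lambda>n. L (s n)) \<longlonglongrightarrow> S l"
    by (simp add: Kt_L S.tendsto)
  then show "l \<in> Kt"
    using W_limit[of s l "S l"] s by (simp add: Kt_iff)
qed

lemma form_Kt_right: "x \<in> Kt \<Longrightarrow> form u x = cinner (L u) x"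
  and form_K_right: "y \<in> K \<Longrightarrow> form u y = cinner (L u) y - cinner u (S y)"
  by (simp_all add: form_eq Kt_iff K_iff cinner.zero_right)

lemma form_K_Kt: "y \<in> K \<Longrightarrow> x \<in> Kt \<Longrightarrow> form y x = 0"
  and form_Kt_K: "x \<in> Kt \<Longrightarrow> y \<in> K \<Longrightarrow> form x y = 0"
  by (simp_all add: form_Kt_right form_K_right K_L Kt_L cinner.zero_left S_hermitian)

lemma form_sum_sum:
  assumes "u0 \<in> W0" "y \<in> K" "x \<in> Kt" "u0' \<in> W0" "y' \<in> K" "x' \<in> Kt"
  shows "form (u0 + y + x) (u0' + y' + x') = form y y' + form x x'"
  using assms csubspace_add[OF csubspace_W]
  by (simp add: form_add_left form_add_right W0_W K_W Kt_W form_W0_left form_W0_right form_K_Kt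
      form_Kt_K)

text \<open>The form is \<open>cinner (S x) x\<close> on \<open>Kt\<close> and the negative of this
  expression on \<open>K\<close>, so coercivity and boundedness of \<open>S\<close> compare it with
  the norm. Both kernels share the same \<open>c\<close> and \<open>M\<close>.\<close>

lemma form_bounds:
  obtains c M where "c > 0" "M > 0" "\<And>x. norm (S x) \<le> M * norm x"
    "\<And>x. c * (norm x)\<^sup>2 \<le> Re (cinner (S x) x)"
    "\<And>x. x \<in> Kt \<Longrightarrow> c * (norm x)\<^sup>2 \<le> Re (form x x)"
    "\<And>x. x \<in> Kt \<Longrightarrow> Re (form x x) \<le> M * (norm x)\<^sup>2"
    "\<And>y. y \<in> K \<Longrightarrow> c * (norm y)\<^sup>2 \<le> - Re (form y y)"
    "\<And>y. y \<in> K \<Longrightarrow> - Re (form y y) \<le> M * (norm y)\<^sup>2"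
proof -
  obtain c where c: "c > 0" "\<And>x. c * (norm x)\<^sup>2 \<le> Re (cinner (S x) x)"
    using S_coercive by blast
  obtain M where M: "M > 0" "\<And>x. norm (S x) \<le> norm x * M"
    using S.pos_bounded by blast
  have upper: "Re (cinner (S x) x) \<le> M * (norm x)\<^sup>2" for x
  proof -
    have "Re (cinner (S x) x) \<le> norm (S x) * norm x"
      by (rule Re_cinner_le)
    also have "\<dots> \<le> norm x * M * norm x"
      by (intro mult_right_mono M) simp
    finally show ?thesis by (simp add: power2_eq_square mult_ac)
  qed
  show ?thesis
    by (rule that[of c M])
      (use c M upper in \<open>auto simp: form_Kt_right form_K_right K_L Kt_L cinner.zero_left mult.commute
        S_hermitian[symmetric]\<close>)
qed

lemma form_Kt_zero: "x \<in> Kt \<Longrightarrow> Re (form x x) \<le> 0 \<Longrightarrow> x = 0"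
  and form_K_zero: "x \<in> K \<Longrightarrow> 0 \<le> Re (form x x) \<Longrightarrow> x = 0"
  using form_bounds
  by (smt (verit) mult_pos_pos norm_eq_zero zero_less_power2)+

section \<open>Range of the closed minimal operator and decomposition of the graph space\<close>

lemma range_W0:
  assumes f: "\<And>x. x \<in> Kt \<Longrightarrow> cinner f x = 0"
  shows "\<exists>u\<in>W0. L u = f"
proof -
  obtain c where c: "c > 0" "\<And>x. c * (norm x)\<^sup>2 \<le> Re (cinner (S x) x)"
    using S_coercive by blast
  \<comment> \<open>The form vanishes on \<open>W0\<close>, so \<open>cinner (S u) u\<close> has
    twice the real part of \<open>cinner (L u) u\<close>, and coercivity bounds \<open>u\<close> by
    \<open>L u\<close>. This is what makes the range closed.\<close>
  have low: "c * norm u \<le> 2 * norm (L u)" if u: "u \<in> W0" for u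
  proof -
    have "form u u = 0"
      using form_W0_left[OF u W0_W[OF u]] .
    then have "Re (cinner (S u) u) = 2 * Re (cinner (L u) u)"
      using cinner_commute[of u "L u"] S_hermitian[of u u]
      by (simp add: form_eq W0_W[OF u] cinner.diff_right complex_eq_iff)
    also have "\<dots> \<le> 2 * (norm (L u) * norm u)"
      using Re_cinner_le[of "L u" u] by simp
    finally have "norm u * (c * norm u) \<le> norm u * (2 * norm (L u))"
      using c(2)[of u] by (simp add: power2_eq_square mult_ac)
    then show ?thesis
      by (cases "u = 0") (simp_all add: mult_le_cancel_left_pos)
  qed
  have cs: "csubspace (L ` W0)"
    unfolding csubspace_def
  proof (intro conjI ballI allI)
    show "0 \<in> L ` W0"
      using csubspace_0[OF csubspace_W0] L_0 by force
    show "x + y \<in> L ` W0" if "x \<in> L ` W0" "y \<in> L ` W0" for x y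
      using that by (auto simp: L_add[symmetric] W0_W csubspace_add[OF csubspace_W0])
    show "a *\<^sub>C x \<in> L ` W0" if "x \<in> L ` W0" for a x
      using that by (auto simp: L_scaleC[symmetric] W0_W csubspace_scaleC[OF csubspace_W0])
  qed
  have closed: "closed (L ` W0)"
    unfolding closed_sequential_limits
  proof (intro allI impI)
    fix y w assume yw: "(\<forall>n. y n \<in> L ` W0) \<and> y \<longlonglongrightarrow> w"
    then have "\<forall>n. \<exists>u. u \<in> W0 \<and> y n = L u"
      by blast
    then obtain u where u: "\<And>n. u n \<in> W0" "\<And>n. y n = L (u n)"
      by metis
    have "Cauchy u"
    proof (rule metric_CauchyI)
      fix e :: real assume "e > 0"
      then have "c * e / 2 > 0"
        using c by simp
      then obtain N where N: "\<And>m n. m \<ge> N \<Longrightarrow> n \<ge> N \<Longrightarrow> dist (y m) (y n) < c * e / 2"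
        using yw metric_CauchyD[OF LIMSEQ_imp_Cauchy] by metis
      show "\<exists>N. \<forall>m\<ge>N. \<forall>n\<ge>N. dist (u m) (u n) < e"
      proof (intro exI allI impI)
        fix m n assume mn: "m \<ge> N" "n \<ge> N"
        have "c * dist (u m) (u n) \<le> 2 * dist (y m) (y n)"
          using low[OF csubspace_diff[OF csubspace_W0 u(1)[of m] u(1)[of n]]]
          by (simp add: dist_norm u L_diff W0_W)
        also have "\<dots> < c * e"
          using N[OF mn] by simp
        finally show "dist (u m) (u n) < e"
          using c by simp
      qed
    qed
    then obtain v where "u \<longlonglongrightarrow> v"
      using Cauchy_convergent convergent_def by blast
    moreover have "(\<lambda>n. L (u n)) \<longlonglongrightarrow> w"
      using yw by (simp add: u(2)[symmetric])
    ultimately show "w \<in> L ` W0"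
      using W0_limit[of u v w] u(1) by blast
  qed
  \<comment> \<open>Orthogonal projection of \<open>f\<close> onto the closed range: the coercive
    equation with the identity in place of \<open>S\<close>.\<close>
  have "\<exists>g\<in>L ` W0. \<forall>x\<in>L ` W0. cinner g x = cinner f x"
    by (rule hermitian_coercive_solution[OF bounded_linear_ident _ zero_less_one _ cs closed])
      (auto simp: cinner_self)
  then obtain u where u: "u \<in> W0" "\<And>x. x \<in> W0 \<Longrightarrow> cinner (L u) (L x) = cinner f (L x)"
    by auto
  define r where "r = f - L u"
  have "cinner (app T0 \<phi>) r = 0" if "\<phi> \<in> D" for \<phi>
  proof -
    have "(\<phi>, app T0 \<phi>) \<in> closure T0"
      using in_linear_op[OF linear_T0(1) that] closure_subset by blast
    then have "L \<phi> = app T0 \<phi>" "\<phi> \<in> W0"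
      using closure_T0 L_eq by (auto simp: W0)
    then have "cinner r (app T0 \<phi>) = 0"
      using u(2)[of \<phi>] by (simp add: r_def cinner.diff_left)
    then show ?thesis
      using cinner_commute[of "app T0 \<phi>" r] by simp
  qed
  \<comment> \<open>Orthogonality to the range of \<open>T0\<close> says that the second maximal
    operator sends \<open>r\<close> to 0. Now \<open>r\<close> is orthogonal to \<open>f\<close> by
    assumption and to \<open>L u\<close> because the form vanishes on \<open>W0\<close>, hence to
    itself.\<close>
  then have r: "r \<in> Kt"
    by (simp add: Kt ker_def Tt1_iff cinner.zero_right)
  have "cinner (L u) r = 0"
    using form_W0_left[OF u(1) Kt_W[OF r]] form_Kt_right[OF r] by simp
  then have "cinner r r = 0"
    using f[OF r] by (simp add: r_def cinner.diff_left)
  then show ?thesis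
    using u(1) by (auto simp: r_def cinner_self)
qed

lemma S_solution:
  assumes "csubspace G" "closed G"
  shows "\<exists>g\<in>G. \<forall>x\<in>G. cinner (S g) x = cinner f x"
proof -
  obtain c where c: "c > 0" "\<And>x. c * (norm x)\<^sup>2 \<le> Re (cinner (S x) x)"
    using S_coercive by blast
  show ?thesis
    by (rule hermitian_coercive_solution[OF bounded_linear_S S_hermitian c assms])
qed

text \<open>The case \<open>U = 0\<close> serves as reference: on \<open>W0 + Kt\<close> the
  operator \<open>T1\<close> acts as \<open>L u0 + S x\<close>. The vector \<open>x\<close> is
  chosen such that \<open>f - S x\<close> is orthogonal to \<open>Kt\<close>, and what remains lies
  in the range of \<open>W0\<close>.\<close>

lemma reference_surjective: "\<exists>u0\<in>W0. \<exists>x\<in>Kt. L u0 + S x = f"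
proof -
  obtain x where x: "x \<in> Kt" "\<And>y. y \<in> Kt \<Longrightarrow> cinner (S x) y = cinner f y"
    using S_solution[OF csubspace_Kt closed_Kt] by blast
  then obtain u0 where "u0 \<in> W0" "L u0 = f - S x"
    using range_W0[of "f - S x"] by (auto simp: cinner.diff_left)
  then show ?thesis
    using x(1) by (intro bexI[of _ u0] bexI[of _ x]) auto
qed

text \<open>Subtracting from \<open>u\<close> a vector of the reference domain with the same image
  under \<open>L\<close> leaves an element of \<open>K\<close>.\<close>

lemma W_decomposition:
  assumes "u \<in> W"
  obtains u0 y x where "u0 \<in> W0" "y \<in> K" "x \<in> Kt" "u = u0 + y + x"
proof -
  obtain u0 x where u0: "u0 \<in> W0" and x: "x \<in> Kt" and eq: "L u0 + S x = L u"
    using reference_surjective by blast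
  have ux: "u0 + x \<in> W"
    using csubspace_add[OF csubspace_W W0_W[OF u0] Kt_W[OF x]] .
  have "L (u - (u0 + x)) = 0"
    using eq assms ux by (simp add: L_diff L_add W0_W[OF u0] Kt_W[OF x] Kt_L[OF x])
  then have "u - (u0 + x) \<in> K"
    using csubspace_diff[OF csubspace_W assms ux] by (simp add: K_iff)
  then show ?thesis
    using that[OF u0 _ x] by simp
qed

text \<open>Pairing \<open>u = u0 + y + x\<close> with its own components isolates them:
  \<open>form u x = form x x\<close> and \<open>form u y = form y y\<close>. The left sides are
  controlled by the graph norm of \<open>u\<close>, and definiteness on the kernels then bounds
  \<open>x\<close> and \<open>y\<close>.\<close>

lemma component_bound:
  obtains C where "\<And>u0 y x. u0 \<in> W0 \<Longrightarrow> y \<in> K \<Longrightarrow> x \<in> Kt \<Longrightarrow>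
    norm y + norm x \<le> C * (norm (u0 + y + x) + norm (L (u0 + y + x)))"
proof -
  obtain c M where c: "c > 0" and M: "M > 0" "\<And>x. norm (S x) \<le> M * norm x"
    and cKt: "\<And>x. x \<in> Kt \<Longrightarrow> c * (norm x)\<^sup>2 \<le> Re (form x x)"
    and cK: "\<And>y. y \<in> K \<Longrightarrow> c * (norm y)\<^sup>2 \<le> - Re (form y y)"
    using form_bounds by metis
  have cancel: "norm z \<le> b / c" if "c * (norm z)\<^sup>2 \<le> b * norm z" "0 \<le> b" for z :: 'h and b
  proof (cases "z = 0")
    case False
    have "norm z * (c * norm z) \<le> norm z * b"
      using that by (simp add: power2_eq_square mult_ac)
    then show ?thesis
      using False c by (simp add: field_simps mult_le_cancel_left_pos)
  qed (use that c in simp)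
  have "norm y + norm x \<le> (2 + M) / c * (norm (u0 + y + x) + norm (L (u0 + y + x)))"
    if u0: "u0 \<in> W0" and y: "y \<in> K" and x: "x \<in> Kt" for u0 y x
  proof -
    define u where "u = u0 + y + x"
    have "form u x = form x x"
      using form_sum_sum[OF u0 y x csubspace_0 csubspace_0 x] csubspace_W0 csubspace_K form_eq
        form_W0_right[OF csubspace_0[OF csubspace_W0] K_W[OF y]]
      by (simp add: u_def)
    then have "Re (form x x) = Re (cinner (L u) x)"
      by (simp add: form_Kt_right[OF x])
    also have "\<dots> \<le> norm (L u) * norm x"
      by (rule Re_cinner_le)
    finally have nx: "norm x \<le> norm (L u) / c"
      using cKt[OF x] by (intro cancel) auto
    have "form u y = form y y"
      using form_sum_sum[OF u0 y x csubspace_0 y csubspace_0] csubspace_W0 csubspace_Kt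
        form_W0_right[OF csubspace_0[OF csubspace_W0] Kt_W[OF x]]
      by (simp add: u_def)
    then have "- Re (form y y) = - Re (form u y)"
      by simp
    also have "\<dots> = Re (cinner u (S y) - cinner (L u) y)"
      by (simp add: form_K_right[OF y])
    also have "\<dots> \<le> norm (cinner u (S y)) + norm (cinner (L u) y)"
      using complex_Re_le_cmod norm_triangle_ineq4 order_trans by blast
    also have "\<dots> \<le> norm u * (M * norm y) + norm (L u) * norm y"
      by (intro add_mono order_trans[OF norm_cinner_le] mult_left_mono M) auto
    finally have ny: "norm y \<le> (M * norm u + norm (L u)) / c"
      using cK[OF y] M(1) by (intro cancel) (auto simp: algebra_simps)
    have "M * norm u + norm (L u) + norm (L u) \<le> (2 + M) * (norm u + norm (L u))"
      using M(1) by (simp add: algebra_simps)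
    then have "(M * norm u + norm (L u) + norm (L u)) / c \<le> (2 + M) * (norm u + norm (L u)) / c"
      using c by (intro divide_right_mono) auto
    then have "norm y + norm x \<le> (2 + M) * (norm u + norm (L u)) / c"
      using nx ny by (simp add: add_divide_distrib)
    then show ?thesis
      by (simp add: u_def)
  qed
  then show ?thesis
    using that by blast
qed

text \<open>The zero vector has graph norm 0, so the component bound annihilates \<open>x\<close>
  and \<open>y\<close>: the sum is direct.\<close>

lemma components_zero:
  assumes "u0 \<in> W0" "y \<in> K" "x \<in> Kt" "u0 + y + x = 0"
  shows "u0 = 0" "y = 0" "x = 0"
proof -
  obtain C where "\<And>u0 y x. u0 \<in> W0 \<Longrightarrow> y \<in> K \<Longrightarrow> x \<in> Kt \<Longrightarrow>
    norm y + norm x \<le> C * (norm (u0 + y + x) + norm (L (u0 + y + x)))"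
    using component_bound by metis
  from this[OF assms(1-3)] have "norm y + norm x \<le> 0"
    using assms(4) L_0 by simp
  then show "y = 0" "x = 0"
    using norm_ge_zero[of x] norm_ge_zero[of y] by (smt (verit) norm_le_zero_iff)+
  then show "u0 = 0"
    using assms(4) by simp
qed

lemma components_unique:
  assumes "u0 \<in> W0" "y \<in> K" "x \<in> Kt" "u0' \<in> W0" "y' \<in> K" "x' \<in> Kt"
    and "u0 + y + x = u0' + y' + x'"
  shows "u0 = u0'" "y = y'" "x = x'"
  using components_zero[OF csubspace_diff[OF csubspace_W0 assms(1,4)]
      csubspace_diff[OF csubspace_K assms(2,5)] csubspace_diff[OF csubspace_Kt assms(3,6)]] assms(7)
  by (simp_all add: algebra_simps)

section \<open>Closed operators from \<open>Kt\<close> to \<open>K\<close> and closed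
  realisations\<close>

definition classifying :: "'h operator \<Rightarrow> bool"
  where "classifying U \<longleftrightarrow> linear_op U \<and> closed U \<and> U \<subseteq> Kt \<times> K"

lemma classifying_app:
  assumes "classifying U" "x \<in> Domain U"
  shows "x \<in> Kt" "app U x \<in> K" "(x, app U x) \<in> U"
  using assms in_linear_op[of U x] by (auto simp: classifying_def)

lemma V_dom_I: "classifying U \<Longrightarrow> u0 \<in> W0 \<Longrightarrow> (x, y) \<in> U \<Longrightarrow> u0 + y + x \<in> V_dom W0 U"
  using linear_op_app_eq[of U x y] unfolding V_dom_def classifying_def by blast

lemma V_dom_E:
  assumes "classifying U" "u \<in> V_dom W0 U"
  obtains u0 y x where "u = u0 + y + x" "u0 \<in> W0" "(x, y) \<in> U" "x \<in> Kt" "y \<in> K"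
  using assms classifying_app[OF assms(1)] unfolding V_dom_def by blast

lemma W0_V_dom: "classifying U \<Longrightarrow> W0 \<subseteq> V_dom W0 U"
  using V_dom_I[of U _ 0 0] csubspace_0[of U]
  by (auto simp: classifying_def linear_op_def zero_prod_def)

lemma V_dom_W: "classifying U \<Longrightarrow> V_dom W0 U \<subseteq> W"
  using V_dom_E csubspace_add[OF csubspace_W] W0_W K_W Kt_W by (metis subsetI)

lemma csubspace_V_dom:
  assumes U: "classifying U"
  shows "csubspace (V_dom W0 U)"
proof -
  have cU: "csubspace U"
    using U by (simp add: classifying_def linear_op_def)
  show ?thesis
    unfolding csubspace_def
  proof (intro conjI ballI allI)
    show "0 \<in> V_dom W0 U"
      using W0_V_dom[OF U] csubspace_0[OF csubspace_W0] by blast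
  next
    fix u v assume "u \<in> V_dom W0 U" "v \<in> V_dom W0 U"
    then obtain u0 y x v0 y' x' where uv: "u = u0 + y + x" "v = v0 + y' + x'"
        "u0 \<in> W0" "v0 \<in> W0" "(x, y) \<in> U" "(x', y') \<in> U"
      using V_dom_E[OF U] by metis
    have "(u0 + v0) + (y + y') + (x + x') \<in> V_dom W0 U"
      using csubspace_add[OF cU uv(5,6)]
      by (intro V_dom_I[OF U] csubspace_add[OF csubspace_W0] uv) simp
    then show "u + v \<in> V_dom W0 U"
      by (simp add: uv algebra_simps)
  next
    fix a u assume "u \<in> V_dom W0 U"
    then obtain u0 y x where u: "u = u0 + y + x" "u0 \<in> W0" "(x, y) \<in> U"
      using V_dom_E[OF U] by metis
    have "a *\<^sub>C u0 + a *\<^sub>C y + a *\<^sub>C x \<in> V_dom W0 U"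
      using csubspace_scaleC[OF cU u(3), of a]
      by (intro V_dom_I[OF U] csubspace_scaleC[OF csubspace_W0] u) (simp add: scaleC_prod_def)
    then show "a *\<^sub>C u \<in> V_dom W0 U"
      by (simp add: u scaleC_add_right)
  qed
qed

text \<open>The component bound applied to \<open>s n - u\<close> makes both kernel components
  converge, and closedness of \<open>U\<close> puts the limiting pair into \<open>U\<close>.\<close>

lemma V_dom_limit:
  assumes U: "classifying U" and s: "\<And>n. s n \<in> V_dom W0 U" "s \<longlonglongrightarrow> u" "(\<lambda>n. L (s n)) \<longlonglongrightarrow> w"
  shows "u \<in> V_dom W0 U"
proof -
  obtain C where C: "\<And>u0 y x. u0 \<in> W0 \<Longrightarrow> y \<in> K \<Longrightarrow> x \<in> Kt \<Longrightarrow>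
    norm y + norm x \<le> C * (norm (u0 + y + x) + norm (L (u0 + y + x)))"
    using component_bound by metis
  have sW: "s n \<in> W" for n
    using V_dom_W[OF U] s(1) by blast
  have u: "u \<in> W" "L u = w"
    using W_limit[OF sW s(2,3)] by auto
  obtain u0 y x where ux: "u0 \<in> W0" "y \<in> K" "x \<in> Kt" "u = u0 + y + x"
    using W_decomposition[OF u(1)] by metis
  have "\<forall>n. \<exists>v0 y' x'. s n = v0 + y' + x' \<and> v0 \<in> W0 \<and> (x', y') \<in> U \<and> x' \<in> Kt \<and> y' \<in> K"
    using V_dom_E[OF U s(1)] by metis
  then obtain v0 y' x' where v: "\<And>n. s n = v0 n + y' n + x' n" "\<And>n. v0 n \<in> W0"
      "\<And>n. (x' n, y' n) \<in> U" "\<And>n. x' n \<in> Kt" "\<And>n. y' n \<in> K"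
    by metis
  have bound: "norm (y' n - y) + norm (x' n - x) \<le> C * (norm (s n - u) + norm (L (s n) - L u))" for n
  proof -
    have "(v0 n - u0) + (y' n - y) + (x' n - x) = s n - u"
      by (simp add: v(1) ux(4))
    then show ?thesis
      using C[OF csubspace_diff[OF csubspace_W0 v(2) ux(1)] csubspace_diff[OF csubspace_K v(5) ux(2)]
          csubspace_diff[OF csubspace_Kt v(4) ux(3)]] L_diff[OF sW u(1)]
      by metis
  qed
  have "(\<lambda>n. C * (norm (s n - u) + norm (L (s n) - L u))) \<longlonglongrightarrow> C * (0 + 0)"
    using s(2,3) by (intro tendsto_mult_left tendsto_add tendsto_norm_zero) (simp_all add: u LIM_zero)
  then have lim0: "(\<lambda>n. C * (norm (s n - u) + norm (L (s n) - L u))) \<longlonglongrightarrow> 0"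
    by simp
  have "(\<lambda>n. y' n - y) \<longlonglongrightarrow> 0" "(\<lambda>n. x' n - x) \<longlonglongrightarrow> 0"
    by (rule Lim_null_comparison[OF _ lim0], rule always_eventually, rule allI,
        rule order_trans[OF _ bound], simp)+
  then have "(\<lambda>n. (x' n, y' n)) \<longlonglongrightarrow> (x, y)"
    by (intro tendsto_Pair) (simp_all add: LIM_zero_iff)
  then have "(x, y) \<in> U"
    using closed_sequentially[of U "\<lambda>n. (x' n, y' n)"] U v(3) by (simp add: classifying_def)
  then show ?thesis
    using V_dom_I[OF U ux(1)] ux(4) by simp
qed

lemma Domain_restrict_op: "V \<subseteq> W \<Longrightarrow> Domain (restrict_op T1 V) = V"
  by (auto simp: restrict_op_def W)

lemma closed_realisation_V_dom:
  assumes U: "classifying U"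
  shows "closed_realisation T0 T1 (restrict_op T1 (V_dom W0 U))"
proof -
  let ?V = "V_dom W0 U"
  have V: "csubspace ?V" "W0 \<subseteq> ?V" "?V \<subseteq> W"
    using csubspace_V_dom W0_V_dom V_dom_W U by auto
  have "csubspace (restrict_op T1 ?V)"
    using linear_T1 V(1) unfolding linear_op_def csubspace_def restrict_op_def
    by (auto simp: zero_prod_def scaleC_prod_def)
  moreover have "single_valued (restrict_op T1 ?V)"
    using linear_T1 by (auto simp: linear_op_def restrict_op_def single_valued_def)
  moreover have "closed (restrict_op T1 ?V)"
    unfolding closed_sequential_limits
  proof (intro allI impI)
    fix s p assume s: "(\<forall>n. s n \<in> restrict_op T1 ?V) \<and> s \<longlonglongrightarrow> p"
    then have s1: "\<And>n. s n \<in> T1" "\<And>n. fst (s n) \<in> ?V" "\<And>n. L (fst (s n)) = snd (s n)"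
      by (auto simp: restrict_op_def mem_Times_iff intro!: L_eq)
    have "fst p \<in> ?V"
      by (rule V_dom_limit[OF U s1(2), where w = "snd p"])
        (use s in \<open>auto simp: s1(3) intro: tendsto_fst tendsto_snd\<close>)
    moreover have "p \<in> T1"
      using closed_sequentially[OF closed_T1, of s p] s1(1) s by blast
    ultimately show "p \<in> restrict_op T1 ?V"
      by (simp add: restrict_op_def mem_Times_iff)
  qed
  moreover have "T0 \<subseteq> restrict_op T1 ?V"
    using V(2) T0_subset_T1 closure_subset[of T0] by (auto simp: restrict_op_def W0)
  ultimately show ?thesis
    by (auto simp: closed_realisation_def linear_op_def restrict_op_def)
qed

lemma Domain_restrict_V_dom: "classifying U \<Longrightarrow> Domain (restrict_op T1 (V_dom W0 U)) = V_dom W0 U"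
  by (rule Domain_restrict_op[OF V_dom_W])

text \<open>By directness of the sum, \<open>y + x\<close> with \<open>(x, y)\<close> in
  \<open>U\<close> can arise in \<open>V_dom W0 U'\<close> only from the same pair; the subspace
  thus determines the graph.\<close>

lemma V_dom_mono_imp:
  assumes U: "classifying U" and U': "classifying U'" and eq: "V_dom W0 U \<subseteq> V_dom W0 U'"
  shows "U \<subseteq> U'"
proof
  fix p assume p: "p \<in> U"
  obtain x y where xy: "p = (x, y)" by fastforce
  have mem: "x \<in> Kt" "y \<in> K"
    using p U xy by (auto simp: classifying_def)
  have "0 + y + x \<in> V_dom W0 U'"
    using V_dom_I[OF U csubspace_0[OF csubspace_W0], of x y] p eq xy by blast
  then obtain u0 y' x' where "0 + y + x = u0 + y' + x'" "u0 \<in> W0" "(x', y') \<in> U'" "x' \<in> Kt" "y' \<in> K"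
    using V_dom_E[OF U'] by metis
  then show "p \<in> U'"
    using components_unique[of 0 y x u0 y' x'] mem csubspace_0[OF csubspace_W0] xy by simp
qed

lemma V_dom_inject:
  "classifying U \<Longrightarrow> classifying U' \<Longrightarrow> V_dom W0 U = V_dom W0 U' \<Longrightarrow> U = U'"
  using V_dom_mono_imp by blast

lemma realisation_props:
  assumes T: "closed_realisation T0 T1 T"
  shows "csubspace (Domain T)" "W0 \<subseteq> Domain T" "Domain T \<subseteq> W" "T = restrict_op T1 (Domain T)"
    "\<And>u. u \<in> Domain T \<Longrightarrow> (u, L u) \<in> T"
proof -
  have lin: "linear_op T" and clo: "closed T" and ext: "T0 \<subseteq> T" and sub: "T \<subseteq> T1"
    using T by (auto simp: closed_realisation_def)
  show "csubspace (Domain T)"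
    by (rule csubspace_Domain_op[OF lin])
  show "W0 \<subseteq> Domain T"
    using closure_minimal[OF ext clo] by (auto simp: W0)
  show "Domain T \<subseteq> W"
    using sub by (auto simp: W)
  show 1: "(u, L u) \<in> T" if "u \<in> Domain T" for u
    using that sub L_eq by blast
  show "T = restrict_op T1 (Domain T)"
    using sub 1 L_eq by (auto simp: restrict_op_def)
qed

lemma realisation_limit:
  assumes T: "closed_realisation T0 T1 T"
    and s: "\<And>n. s n \<in> Domain T" "s \<longlonglongrightarrow> u" "(\<lambda>n. L (s n)) \<longlonglongrightarrow> w"
  shows "u \<in> Domain T"
proof -
  have "(u, w) \<in> T"
    by (rule closed_sequentially[of T "\<lambda>n. (s n, L (s n))"])
      (use T s realisation_props(5)[OF T] in \<open>auto simp: closed_realisation_def intro: tendsto_Pair\<close>)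
  then show ?thesis by blast
qed

definition rel :: "'h set \<Rightarrow> 'h operator"
  where "rel V = {(x, y). x \<in> Kt \<and> y \<in> K \<and> y + x \<in> V}"

text \<open>Two values at one argument differ by an element of \<open>Domain T \<inter> K\<close>,
  whence single-valuedness. For closedness, \<open>L (y + x) = S x\<close> on pairs of the relation,
  so convergence of both entries is already convergence in the graph norm.\<close>

lemma classifying_rel:
  assumes T: "closed_realisation T0 T1 T" and inter: "Domain T \<inter> K \<subseteq> {0}"
  shows "classifying (rel (Domain T))"
proof -
  note V = realisation_props[OF T]
  let ?U = "rel (Domain T)"
  have cs: "csubspace ?U"
    unfolding csubspace_def
  proof (intro conjI ballI allI)
    show "0 \<in> ?U"
      using csubspace_0 V(1) csubspace_K csubspace_Kt by (auto simp: rel_def zero_prod_def)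
  next
    fix p q assume pq: "p \<in> ?U" "q \<in> ?U"
    have "snd p + fst p + (snd q + fst q) \<in> Domain T"
      by (rule csubspace_add[OF V(1)]) (use pq in \<open>auto simp: rel_def\<close>)
    moreover have "snd p + fst p + (snd q + fst q) = snd (p + q) + fst (p + q)"
      by simp
    ultimately show "p + q \<in> ?U"
      using pq by (auto simp: rel_def csubspace_add csubspace_K csubspace_Kt)
  next
    fix a p assume "p \<in> ?U"
    then show "a *\<^sub>C p \<in> ?U"
      using csubspace_scaleC[OF V(1), of "snd p + fst p" a]
      by (cases p) (simp add: rel_def scaleC_prod_def scaleC_add_right csubspace_scaleC csubspace_K
          csubspace_Kt)
  qed
  have sv: "single_valued ?U"
  proof (rule single_valuedI)
    fix x y z assume xyz: "(x, y) \<in> ?U" "(x, z) \<in> ?U"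
    then have mem: "y + x \<in> Domain T" "z + x \<in> Domain T" "y \<in> K" "z \<in> K"
      by (auto simp: rel_def)
    have "(y + x) - (z + x) \<in> Domain T" "y - z \<in> K"
      by (intro csubspace_diff[OF V(1)] csubspace_diff[OF csubspace_K] mem)+
    then show "y = z"
      using inter by auto
  qed
  have "closed ?U"
    unfolding closed_sequential_limits
  proof (intro allI impI)
    fix s p assume s: "(\<forall>n. s n \<in> ?U) \<and> s \<longlonglongrightarrow> p"
    then have mem: "\<And>n. fst (s n) \<in> Kt" "\<And>n. snd (s n) \<in> K" "\<And>n. snd (s n) + fst (s n) \<in> Domain T"
      by (auto simp: rel_def case_prod_unfold)
    have lim: "(\<lambda>n. fst (s n)) \<longlonglongrightarrow> fst p" "(\<lambda>n. snd (s n)) \<longlonglongrightarrow> snd p"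
      using s by (auto intro: tendsto_fst tendsto_snd)
    have "L (snd (s n) + fst (s n)) = S (fst (s n))" for n
      using mem[of n] by (simp add: L_add K_W Kt_W K_L Kt_L)
    then have "snd p + fst p \<in> Domain T"
      by (intro realisation_limit[OF T mem(3) tendsto_add[OF lim(2,1)], of "S (fst p)"])
        (simp add: S.tendsto lim)
    moreover have "fst p \<in> Kt" "snd p \<in> K"
      using closed_sequentially[OF closed_Kt mem(1) lim(1)]
        closed_sequentially[OF closed_K mem(2) lim(2)] by auto
    ultimately show "p \<in> ?U"
      by (simp add: rel_def case_prod_unfold)
  qed
  then show ?thesis
    using cs sv by (auto simp: classifying_def linear_op_def rel_def)
qed

lemma V_dom_rel:
  assumes T: "closed_realisation T0 T1 T" and inter: "Domain T \<inter> K \<subseteq> {0}"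
  shows "V_dom W0 (rel (Domain T)) = Domain T"
proof (intro equalityI subsetI)
  note V = realisation_props[OF T] and U = classifying_rel[OF T inter]
  show "u \<in> Domain T" if "u \<in> V_dom W0 (rel (Domain T))" for u
    using that
  proof (rule V_dom_E[OF U])
    fix u0 y x assume u: "u = u0 + y + x" "u0 \<in> W0" "(x, y) \<in> rel (Domain T)"
    have "u0 + (y + x) \<in> Domain T"
      by (rule csubspace_add[OF V(1)]) (use u V(2) in \<open>auto simp: rel_def\<close>)
    then show "u \<in> Domain T"
      by (simp add: u add.assoc)
  qed
  fix u assume u: "u \<in> Domain T"
  then obtain u0 y x where ux: "u0 \<in> W0" "y \<in> K" "x \<in> Kt" "u = u0 + y + x"
    using W_decomposition V(3) by blast
  have "u - u0 \<in> Domain T"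
    using csubspace_diff[OF V(1) u] V(2) ux(1) by blast
  then have "y + x \<in> Domain T"
    by (simp add: ux(4) add.assoc)
  then have "(x, y) \<in> rel (Domain T)"
    using ux by (simp add: rel_def)
  then show "u \<in> V_dom W0 (rel (Domain T))"
    unfolding ux(4) by (intro V_dom_I[OF U] ux)
qed

text \<open>Each of the five correspondences is an instance: the equivalence for \<open>Q\<close>
  gives surjectivity, and injectivity is uniqueness of components. The map to realisations and the
  map to domains are treated together because a realisation is determined by its domain.\<close>

lemma classifies_if:
  assumes Us: "\<And>U. U \<in> Us \<Longrightarrow> classifying U"
    and Q: "\<And>T. closed_realisation T0 T1 T \<Longrightarrow> Q T \<longleftrightarrow> (\<exists>U. U \<in> Us \<and> Domain T = V_dom W0 U)"
  shows "classifies T1 W0 Us {T. closed_realisation T0 T1 T \<and> Q T}"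
proof -
  let ?R = "\<lambda>U. restrict_op T1 (V_dom W0 U)"
  let ?Ts = "{T. closed_realisation T0 T1 T \<and> Q T}"
  \<comment> \<open>The equivalence is read backwards, at the realisation built from
    \<open>U\<close>.\<close>
  have in_Ts: "?R U \<in> ?Ts" if "U \<in> Us" for U
    using closed_realisation_V_dom[OF Us[OF that]] Domain_restrict_V_dom[OF Us[OF that]] Q that by auto
  have "?R ` Us = ?Ts"
  proof (intro equalityI subsetI)
    fix T assume "T \<in> ?Ts"
    then obtain U where "U \<in> Us" "Domain T = V_dom W0 U" "closed_realisation T0 T1 T"
      using Q by auto
    then show "T \<in> ?R ` Us"
      using realisation_props(4)[of T] by auto
  qed (use in_Ts in blast)
  moreover have "Domain ` ?R ` Us = V_dom W0 ` Us"
    using Domain_restrict_V_dom[OF Us] by (auto simp: image_image intro!: image_cong)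
  ultimately have "V_dom W0 ` Us = Domain ` ?Ts"
    by simp
  moreover have "inj_on (V_dom W0) Us"
    by (intro inj_onI V_dom_inject[OF Us Us])
  moreover have "inj_on ?R Us"
  proof (rule inj_onI)
    fix U U' assume UU: "U \<in> Us" "U' \<in> Us" and "?R U = ?R U'"
    then have "V_dom W0 U = V_dom W0 U'"
      using Domain_restrict_V_dom[OF Us] by metis
    then show "U = U'"
      by (rule V_dom_inject[OF Us[OF UU(1)] Us[OF UU(2)]])
  qed
  ultimately show ?thesis
    using \<open>?R ` Us = ?Ts\<close> by (simp add: classifies_def bij_betw_def)
qed

section \<open>Classification of realisations\<close>

text \<open>\<open>sqrt\<close> is strictly increasing on all reals, so the norms can be squared out
  whatever the sign of the form.\<close>

lemma form_norm_iff:
  "form_norm (\<lambda>u v. - form u v) y \<le> form_norm form x \<longleftrightarrow> - Re (form y y) \<le> Re (form x x)"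
  "form_norm (\<lambda>u v. - form u v) y = form_norm form x \<longleftrightarrow> - Re (form y y) = Re (form x x)"
  by (auto simp: form_norm_def)

text \<open>Closedness is a matter of the norm of the Hilbert space, contractivity one of the form;
  \<open>sqrt (M / c)\<close> converts between them in both directions.\<close>

lemma form_bound_imp_norm_bound:
  obtains C where "\<And>x y. x \<in> Kt \<Longrightarrow> y \<in> K \<Longrightarrow> - Re (form y y) \<le> Re (form x x) \<Longrightarrow> norm y \<le> C * norm x"
    "\<And>x y. x \<in> Kt \<Longrightarrow> y \<in> K \<Longrightarrow> Re (form x x) \<le> - Re (form y y) \<Longrightarrow> norm x \<le> C * norm y"
proof -
  obtain c M where c: "c > 0" and M: "M > 0"
    and b: "\<And>x. x \<in> Kt \<Longrightarrow> c * (norm x)\<^sup>2 \<le> Re (form x x)"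
      "\<And>x. x \<in> Kt \<Longrightarrow> Re (form x x) \<le> M * (norm x)\<^sup>2"
      "\<And>y. y \<in> K \<Longrightarrow> c * (norm y)\<^sup>2 \<le> - Re (form y y)"
      "\<And>y. y \<in> K \<Longrightarrow> - Re (form y y) \<le> M * (norm y)\<^sup>2"
    using form_bounds by metis
  have root: "norm y \<le> sqrt (M / c) * norm x" if "c * (norm y)\<^sup>2 \<le> M * (norm x)\<^sup>2" for x y :: 'h
  proof -
    have "(norm y)\<^sup>2 \<le> M / c * (norm x)\<^sup>2"
      using that c by (simp add: field_simps)
    then have "sqrt ((norm y)\<^sup>2) \<le> sqrt (M / c * (norm x)\<^sup>2)"
      by (rule real_sqrt_le_mono)
    then show ?thesis
      unfolding real_sqrt_mult by simp
  qed
  show ?thesis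
  proof (rule that[of "sqrt (M / c)"])
    fix x y assume xy: "x \<in> Kt" "y \<in> K"
    show "norm y \<le> sqrt (M / c) * norm x" if "- Re (form y y) \<le> Re (form x x)"
      using b(2)[OF xy(1)] b(3)[OF xy(2)] that by (intro root) linarith
    show "norm x \<le> sqrt (M / c) * norm y" if "Re (form x x) \<le> - Re (form y y)"
      using b(1)[OF xy(1)] b(4)[OF xy(2)] that by (intro root) linarith
  qed
qed

text \<open>Phrased on pairs of the graph and with squared form norms, the condition refers to no
  separately named domain and compares directly with the sign of the form on
  \<open>V_dom W0 U\<close>.\<close>

definition contractive :: "'h operator \<Rightarrow> bool"
  where "contractive U \<longleftrightarrow> (\<forall>(x, y)\<in>U. - Re (form y y) \<le> Re (form x x))"

definition isometric :: "'h operator \<Rightarrow> bool"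
  where "isometric U \<longleftrightarrow> (\<forall>(x, y)\<in>U. - Re (form y y) = Re (form x x))"

lemma isometric_imp_contractive: "isometric U \<Longrightarrow> contractive U"
  by (auto simp: isometric_def contractive_def)

lemma nonexpansive_iff:
  "nonexpansive_operator G form K (\<lambda>u v. - form u v) U \<longleftrightarrow>
    operator_between G K U \<and> contractive U"
  using linear_op_ball_iff[of U "\<lambda>x y. - Re (form y y) \<le> Re (form x x)"]
  by (auto simp: nonexpansive_operator_def operator_between_def contractive_def form_norm_iff)

lemma unitary_iff:
  "unitary_operator G form H (\<lambda>u v. - form u v) U \<longleftrightarrow>
    operator_between G H U \<and> Range U = H \<and> isometric U"
  using linear_op_ball_iff[of U "\<lambda>x y. - Re (form y y) = Re (form x x)"]
  by (auto simp: unitary_operator_def operator_between_def isometric_def form_norm_iff)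

lemma contractive_norm_bound:
  assumes "U \<subseteq> Kt \<times> K" "contractive U"
  obtains C where "\<And>x y. (x, y) \<in> U \<Longrightarrow> norm y \<le> C * norm x"
proof -
  obtain C where C: "\<And>x y. x \<in> Kt \<Longrightarrow> y \<in> K \<Longrightarrow> - Re (form y y) \<le> Re (form x x) \<Longrightarrow> norm y \<le> C * norm x"
    using form_bound_imp_norm_bound by metis
  show ?thesis
    by (rule that[of C]) (use assms in \<open>auto simp: contractive_def intro: C\<close>)
qed

lemma classifying_bounded:
  assumes "bounded_operator Kt K U"
  shows "classifying U"
proof -
  have "linear_op U" "Domain U = Kt" "U \<subseteq> Kt \<times> K"
    using assms by (auto simp: bounded_operator_def operator_between_def)
  moreover obtain C where "\<And>x. x \<in> Domain U \<Longrightarrow> norm (app U x) \<le> C * norm x"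
    using assms by (auto simp: bounded_operator_def operator_between_def)
  ultimately show ?thesis
    using closed_if_bounded[of U C] closed_Kt by (simp add: classifying_def)
qed

lemma closed_subspace_Kt: "closed_subspace_of Kt Kt"
  by (simp add: closed_subspace_of_def csubspace_Kt closed_Kt)

lemma classifying_contractive:
  assumes G: "closed_subspace_of G Kt" and U: "operator_between G K U" "contractive U"
  shows "classifying U"
proof -
  have U': "linear_op U" "Domain U = G" "U \<subseteq> Kt \<times> K"
    using U(1) G by (auto simp: operator_between_def closed_subspace_of_def)
  obtain C where C: "\<And>x y. (x, y) \<in> U \<Longrightarrow> norm y \<le> C * norm x"
    using contractive_norm_bound[OF U'(3) U(2)] by metis
  have "closed (Domain U)"
    using U'(2) G by (simp add: closed_subspace_of_def)
  then have "closed U"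
    by (rule closed_if_bounded[OF U'(1)]) (rule C[OF in_linear_op[OF U'(1)]])
  then show ?thesis
    using U' by (simp add: classifying_def)
qed

text \<open>A closed graph with a norm bound has a closed domain, so the closed subspace demanded in
  case (ii) is recovered as \<open>Domain U\<close>.\<close>

lemma contractive_domain:
  assumes U: "classifying U" "contractive U"
  shows "closed_subspace_of (Domain U) Kt" "operator_between (Domain U) K U"
proof -
  have U': "csubspace U" "closed U" "U \<subseteq> Kt \<times> K"
    using U(1) by (auto simp: classifying_def linear_op_def)
  obtain C where C: "\<And>x y. (x, y) \<in> U \<Longrightarrow> norm y \<le> C * norm x"
    using contractive_norm_bound[OF U'(3) U(2)] by metis
  then show "closed_subspace_of (Domain U) Kt"
    using closed_Domain_if_bounded[OF U'(1,2) C] csubspace_Domain[OF U'(1)] U'(3)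
    unfolding closed_subspace_of_def by blast
  show "operator_between (Domain U) K U"
    using U by (auto simp: operator_between_def classifying_def)
qed

text \<open>Isometry bounds the argument by the value as well, so the argument for closed domains
  applies to \<open>U\<inverse>\<close>, whose domain is the range of \<open>U\<close>.\<close>

lemma isometric_range:
  assumes U: "classifying U" "isometric U"
  shows "closed_subspace_of (Range U) K"
proof -
  have U': "csubspace U" "closed U" "U \<subseteq> Kt \<times> K"
    using U(1) by (auto simp: classifying_def linear_op_def)
  obtain C where C: "\<And>x y. x \<in> Kt \<Longrightarrow> y \<in> K \<Longrightarrow> Re (form x x) \<le> - Re (form y y) \<Longrightarrow> norm x \<le> C * norm y"
    using form_bound_imp_norm_bound by metis
  have "csubspace (U\<inverse>)"
    by (rule csubspace_converse[OF U'(1)])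
  moreover have "closed (U\<inverse>)"
    unfolding closed_sequential_limits
  proof (intro allI impI)
    fix s p assume s: "(\<forall>n. s n \<in> U\<inverse>) \<and> s \<longlonglongrightarrow> p"
    have "(\<lambda>n. (snd (s n), fst (s n))) \<longlonglongrightarrow> (snd p, fst p)"
      using s by (intro tendsto_Pair tendsto_fst tendsto_snd) auto
    moreover have "(snd (s n), fst (s n)) \<in> U" for n
      using s by (metis converse_iff prod.collapse)
    ultimately have "(snd p, fst p) \<in> U"
      using closed_sequentially[OF U'(2), of "\<lambda>n. (snd (s n), fst (s n))"] by blast
    then show "p \<in> U\<inverse>"
      by (metis converse_iff prod.collapse)
  qed
  moreover have "norm y \<le> C * norm x" if "(x, y) \<in> U\<inverse>" for x y
    using that U(2) U'(3) by (intro C) (auto simp: isometric_def)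
  ultimately have "closed (Domain (U\<inverse>))"
    by (rule closed_Domain_if_bounded)
  then show ?thesis
    using U' by (auto simp: closed_subspace_of_def csubspace_Range)
qed

section \<open>Sign conditions, isotropy and adjoints\<close>

lemma V_dom_form:
  assumes U: "classifying U" and u: "u0 \<in> W0" "(x, y) \<in> U" and v: "v0 \<in> W0" "x' \<in> Kt" "y' \<in> K"
  shows "form (u0 + y + x) (v0 + y' + x') = form y y' + form x x'"
  using U u by (intro form_sum_sum v) (auto simp: classifying_def)

lemma V_dom_nonneg_iff:
  assumes U: "classifying U"
  shows "V_dom W0 U \<subseteq> nonneg_cone W form \<longleftrightarrow> contractive U"
proof
  assume V: "V_dom W0 U \<subseteq> nonneg_cone W form"
  show "contractive U"
    unfolding contractive_def
  proof clarify
    fix x y assume xy: "(x, y) \<in> U"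
    then have "x \<in> Kt" "y \<in> K"
      using U by (auto simp: classifying_def)
    moreover have "0 \<le> Re (form (0 + y + x) (0 + y + x))"
      using V V_dom_I[OF U csubspace_0[OF csubspace_W0] xy] in_nonneg_cone by blast
    ultimately show "- Re (form y y) \<le> Re (form x x)"
      using V_dom_form[OF U csubspace_0[OF csubspace_W0] xy csubspace_0[OF csubspace_W0]] by simp
  qed
next
  assume c: "contractive U"
  show "V_dom W0 U \<subseteq> nonneg_cone W form"
  proof
    fix u assume u: "u \<in> V_dom W0 U"
    then obtain u0 y x where ux: "u = u0 + y + x" "u0 \<in> W0" "(x, y) \<in> U" "x \<in> Kt" "y \<in> K"
      using V_dom_E[OF U] by metis
    have "form u u = form y y + form x x"
      using V_dom_form[OF U ux(2,3,2,4,5)] by (simp add: ux(1))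
    then show "u \<in> nonneg_cone W form"
      using c ux(3) u V_dom_W[OF U] by (auto simp: in_nonneg_cone contractive_def)
  qed
qed

lemma V_dom_isotropic_iff:
  assumes U: "classifying U"
  shows "(\<forall>u\<in>V_dom W0 U. form u u = 0) \<longleftrightarrow> isometric U"
proof
  assume V: "\<forall>u\<in>V_dom W0 U. form u u = 0"
  show "isometric U"
    unfolding isometric_def
  proof clarify
    fix x y assume xy: "(x, y) \<in> U"
    then have "x \<in> Kt" "y \<in> K"
      using U by (auto simp: classifying_def)
    moreover have "form (0 + y + x) (0 + y + x) = 0"
      using V V_dom_I[OF U csubspace_0[OF csubspace_W0] xy] by blast
    ultimately have "form y y + form x x = 0"
      using V_dom_form[OF U csubspace_0[OF csubspace_W0] xy csubspace_0[OF csubspace_W0]] by simp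
    then show "- Re (form y y) = Re (form x x)"
      by (simp add: complex_eq_iff)
  qed
next
  assume i: "isometric U"
  show "\<forall>u\<in>V_dom W0 U. form u u = 0"
  proof
    fix u assume u: "u \<in> V_dom W0 U"
    then obtain u0 y x where ux: "u = u0 + y + x" "u0 \<in> W0" "(x, y) \<in> U" "x \<in> Kt" "y \<in> K"
      using V_dom_E[OF U] by metis
    have "form u u = form y y + form x x"
      using V_dom_form[OF U ux(2,3,2,4,5)] by (simp add: ux(1))
    then show "form u u = 0"
      using i ux(3) form_self_real[OF K_W[OF ux(5)]] form_self_real[OF Kt_W[OF ux(4)]]
      by (auto simp: isometric_def complex_eq_iff)
  qed
qed

lemma classifying_of_realisation:
  assumes T: "closed_realisation T0 T1 T" and inter: "\<And>y. y \<in> Domain T \<Longrightarrow> y \<in> K \<Longrightarrow> y = 0"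
  obtains U where "classifying U" "Domain T = V_dom W0 U"
proof -
  have "Domain T \<inter> K \<subseteq> {0}"
    using inter by blast
  then show ?thesis
    using that classifying_rel[OF T] V_dom_rel[OF T] by metis
qed

text \<open>The form is negative definite on \<open>K\<close>, so a non-negative domain meets
  \<open>K\<close> only in 0 and comes from an operator.\<close>

lemma nonneg_realisation_iff:
  assumes T: "closed_realisation T0 T1 T"
  shows "Domain T \<subseteq> nonneg_cone W form \<longleftrightarrow>
    (\<exists>U. classifying U \<and> contractive U \<and> Domain T = V_dom W0 U)"
proof
  assume V: "Domain T \<subseteq> nonneg_cone W form"
  have z: "y = 0" if "y \<in> Domain T" "y \<in> K" for y
    using V that form_K_zero[of y] in_nonneg_cone[of y] by blast
  obtain U where "classifying U" "Domain T = V_dom W0 U"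
    by (rule classifying_of_realisation[OF T z])
  then show "\<exists>U. classifying U \<and> contractive U \<and> Domain T = V_dom W0 U"
    using V V_dom_nonneg_iff by metis
qed (use V_dom_nonneg_iff in metis)

text \<open>Since \<open>T\<close> extends \<open>T0\<close>, its adjoint lies inside the second
  maximal operator, so its pairs are \<open>(v, S v - L v)\<close>. For such a pair the adjoint
  identity over \<open>T\<close> is the vanishing of \<open>form u v\<close>.\<close>

lemma Domain_adjoint_realisation:
  assumes T: "closed_realisation T0 T1 T"
  shows "Domain (adjoint_op T) = form_orthogonal W form (Domain T)"
proof (intro equalityI subsetI)
  note V = realisation_props[OF T]
  fix v assume "v \<in> Domain (adjoint_op T)"
  then obtain w where w: "(v, w) \<in> adjoint_op T"
    by blast
  then have "(v, w) \<in> Tt1"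
    using T by (auto simp: Tt1 adjoint_op_def closed_realisation_def)
  then have v: "v \<in> W" "L v = S v - w"
    using T1_W L_eq by (auto simp: Tt1_iff_T1)
  have "form v u = 0" if "u \<in> Domain T" for u
  proof -
    have "cinner (L u) v = cinner u w"
      using w V(5)[OF that] by (auto simp: adjoint_op_def)
    then have "form u v = 0"
      by (simp add: form_eq v)
    then show ?thesis
      using form_commute[of u v] v V(3) that by auto
  qed
  then show "v \<in> form_orthogonal W form (Domain T)"
    using v by (simp add: form_orthogonal_def)
next
  note V = realisation_props[OF T]
  fix v assume "v \<in> form_orthogonal W form (Domain T)"
  then have v: "v \<in> W" "\<And>u. u \<in> Domain T \<Longrightarrow> form v u = 0"
    by (auto simp: form_orthogonal_def)
  have "cinner z v = cinner u (S v - L v)" if "(u, z) \<in> T" for u z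
  proof -
    have u: "u \<in> Domain T" "z = L u"
      using that T L_eq by (auto simp: closed_realisation_def)
    then have "form u v = 0"
      using form_commute[of v u] v V(3) by auto
    then show ?thesis
      by (simp add: u(2) form_eq v(1))
  qed
  then show "v \<in> Domain (adjoint_op T)"
    by (auto simp: adjoint_op_def)
qed

text \<open>Polarisation: the diagonal value at \<open>u + v\<close> gives the real part of
  \<open>form u v\<close>, and \<open>\<i> *\<^sub>C v\<close> in place of \<open>v\<close> gives
  the imaginary part.\<close>

lemma isotropic_iff:
  assumes V: "csubspace V" "V \<subseteq> W"
  shows "V \<subseteq> form_orthogonal W form V \<longleftrightarrow> (\<forall>u\<in>V. form u u = 0)"
proof
  assume z: "\<forall>u\<in>V. form u u = 0"
  have re: "Re (form u v) = 0" if uv: "u \<in> V" "v \<in> V" for u v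
  proof -
    have W: "u \<in> W" "v \<in> W"
      using uv V(2) by auto
    have "form (u + v) (u + v) = 0"
      using z csubspace_add[OF V(1) uv] by blast
    then have "cnj (form u v) + form u v = 0"
      using z uv W by (simp add: form_add_left form_add_right csubspace_add csubspace_W
          form_commute[of u v])
    then show ?thesis
      by (simp add: complex_eq_iff)
  qed
  have "form u v = 0" if uv: "u \<in> V" "v \<in> V" for u v
  proof (rule complex_eqI)
    have "u \<in> W" "v \<in> W"
      using uv V(2) by auto
    then show "Im (form u v) = Im 0"
      using re[OF uv(1) csubspace_scaleC[OF V(1) uv(2), of \<i>]] by (simp add: form_scaleC_right)
  qed (use re uv in simp)
  then show "V \<subseteq> form_orthogonal W form V"
    using V by (auto simp: form_orthogonal_def)
qed (auto simp: form_orthogonal_def)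

lemma isotropic_realisation_iff:
  assumes T: "closed_realisation T0 T1 T"
  shows "Domain T \<subseteq> Domain (adjoint_op T) \<longleftrightarrow>
    (\<exists>U. classifying U \<and> isometric U \<and> Domain T = V_dom W0 U)"
proof -
  note V = realisation_props[OF T]
  have iff: "Domain T \<subseteq> Domain (adjoint_op T) \<longleftrightarrow> (\<forall>u\<in>Domain T. form u u = 0)"
    using isotropic_iff[OF V(1,3)] Domain_adjoint_realisation[OF T] by simp
  show ?thesis
  proof
    assume V: "Domain T \<subseteq> Domain (adjoint_op T)"
    have z: "y = 0" if "y \<in> Domain T" "y \<in> K" for y
    proof -
      have "form y y = 0"
        using that V iff by blast
      then show ?thesis
        using form_K_zero that by simp
    qed
    obtain U where "classifying U" "Domain T = V_dom W0 U"
      by (rule classifying_of_realisation[OF T z])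
    then show "\<exists>U. classifying U \<and> isometric U \<and> Domain T = V_dom W0 U"
      using V iff V_dom_isotropic_iff by metis
  qed (use iff V_dom_isotropic_iff in metis)
qed

text \<open>A vector of \<open>Kt\<close> sees only the \<open>Kt\<close> component under the form,
  so orthogonality inside the kernel carries over to the whole subspace. This feeds the definiteness
  argument for a full domain.\<close>

lemma V_dom_orthogonal_Kt:
  assumes U: "classifying U" and z: "z \<in> Kt" "\<And>x. x \<in> Domain U \<Longrightarrow> form z x = 0"
  shows "z \<in> form_orthogonal W form (V_dom W0 U)"
proof -
  have "form z u = 0" if u: "u \<in> V_dom W0 U" for u
  proof -
    obtain u0 y x where ux: "u = u0 + y + x" "u0 \<in> W0" "(x, y) \<in> U" "x \<in> Kt" "y \<in> K"
      using V_dom_E[OF U u] by metis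
    have "form z x = 0"
      using z(2) ux(3) by blast
    then show ?thesis
      using ux Kt_W[OF z(1)] csubspace_add[OF csubspace_W]
      by (simp add: form_add_right form_W0_right form_Kt_K[OF z(1)] W0_W K_W Kt_W)
  qed
  then show ?thesis
    using Kt_W[OF z(1)] by (simp add: form_orthogonal_def)
qed

lemma V_dom_orthogonal_K:
  assumes U: "classifying U" and z: "z \<in> K" "\<And>y. y \<in> Range U \<Longrightarrow> form z y = 0"
  shows "z \<in> form_orthogonal W form (V_dom W0 U)"
proof -
  have "form z u = 0" if u: "u \<in> V_dom W0 U" for u
  proof -
    obtain u0 y x where ux: "u = u0 + y + x" "u0 \<in> W0" "(x, y) \<in> U" "x \<in> Kt" "y \<in> K"
      using V_dom_E[OF U u] by metis
    have "form z y = 0"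
      using z(2) ux(3) by blast
    then show ?thesis
      using ux K_W[OF z(1)] csubspace_add[OF csubspace_W]
      by (simp add: form_add_right form_W0_right form_K_Kt[OF z(1)] W0_W K_W Kt_W)
  qed
  then show ?thesis
    using K_W[OF z(1)] by (simp add: form_orthogonal_def)
qed

text \<open>As the form on \<open>Kt\<close> is \<open>cinner (S w) x\<close>, the coercive equation
  on \<open>G\<close> with right-hand side \<open>S w\<close> produces the form-orthogonal
  projection of \<open>w\<close> onto \<open>G\<close>; the assumption removes the
  remainder.\<close>

lemma Kt_eq_if_no_orthogonal:
  assumes G: "closed_subspace_of G Kt"
    and z: "\<And>z. z \<in> Kt \<Longrightarrow> (\<And>x. x \<in> G \<Longrightarrow> form z x = 0) \<Longrightarrow> z = 0"
  shows "G = Kt"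
proof (intro equalityI subsetI)
  fix w assume w: "w \<in> Kt"
  obtain g where g: "g \<in> G" "\<And>x. x \<in> G \<Longrightarrow> cinner (S g) x = cinner (S w) x"
    using S_solution[of G "S w"] G by (auto simp: closed_subspace_of_def)
  have gK: "g \<in> Kt"
    using g(1) G by (auto simp: closed_subspace_of_def)
  have "w - g = 0"
  proof (rule z)
    show d: "w - g \<in> Kt"
      by (rule csubspace_diff[OF csubspace_Kt w gK])
    show "form (w - g) x = 0" if "x \<in> G" for x
      using that G g(2)[OF that] d
      by (auto simp: closed_subspace_of_def form_Kt_right Kt_L S.diff cinner.diff_left)
  qed
  then show "w \<in> G"
    using g(1) by simp
qed (use G in \<open>auto simp: closed_subspace_of_def\<close>)

text \<open>The same projection argument: on \<open>K\<close> the form only changes sign, which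
  leaves orthogonality unaffected.\<close>

lemma K_eq_if_no_orthogonal:
  assumes G: "closed_subspace_of G K"
    and z: "\<And>z. z \<in> K \<Longrightarrow> (\<And>x. x \<in> G \<Longrightarrow> form z x = 0) \<Longrightarrow> z = 0"
  shows "G = K"
proof (intro equalityI subsetI)
  fix w assume w: "w \<in> K"
  obtain g where g: "g \<in> G" "\<And>x. x \<in> G \<Longrightarrow> cinner (S g) x = cinner (S w) x"
    using S_solution[of G "S w"] G by (auto simp: closed_subspace_of_def)
  have gK: "g \<in> K"
    using g(1) G by (auto simp: closed_subspace_of_def)
  have "w - g = 0"
  proof (rule z)
    show d: "w - g \<in> K"
      by (rule csubspace_diff[OF csubspace_K w gK])
    show "form (w - g) x = 0" if "x \<in> G" for x
      using that G g(2)[OF that] d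
      by (auto simp: closed_subspace_of_def form_K_right K_L S.diff cinner.diff_left
          S_hermitian[symmetric] cinner.zero_left)
  qed
  then show "w \<in> G"
    using g(1) by simp
qed (use G in \<open>auto simp: closed_subspace_of_def\<close>)

text \<open>If \<open>v = v0 + y + x\<close> is orthogonal to \<open>U x + x\<close>, then
  \<open>2 \<parallel>x\<parallel>\<^sup>2 = 2 Re \<langle>y, U x\<rangle> \<le> \<parallel>y\<parallel>\<^sup>2 + \<parallel>U x\<parallel>\<^sup>2 \<le> \<parallel>y\<parallel>\<^sup>2 + \<parallel>x\<parallel>\<^sup>2\<close> in the form norms.\<close>

lemma contractive_orthogonal_nonpos:
  assumes U: "classifying U" "contractive U" and full: "Domain U = Kt"
  shows "form_orthogonal W form (V_dom W0 U) \<subseteq> nonpos_cone W form"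
proof
  fix v assume v: "v \<in> form_orthogonal W form (V_dom W0 U)"
  then have vW: "v \<in> W"
    by (simp add: form_orthogonal_def)
  obtain v0 y x where vx: "v0 \<in> W0" "y \<in> K" "x \<in> Kt" "v = v0 + y + x"
    using W_decomposition[OF vW] by metis
  obtain y' where y': "(x, y') \<in> U"
    using full vx(3) by blast
  then have y'K: "y' \<in> K"
    using U(1) by (auto simp: classifying_def)
  have "form v (0 + y' + x) = 0"
    using v V_dom_I[OF U(1) csubspace_0[OF csubspace_W0] y'] by (simp add: form_orthogonal_def)
  then have "form y y' + form x x = 0"
    using form_sum_sum[OF vx(1-3) csubspace_0[OF csubspace_W0] y'K vx(3)] by (simp add: vx(4))
  then have 1: "Re (form y y') = - Re (form x x)"
    by (simp add: complex_eq_iff)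
  obtain c where c: "c > 0" "\<And>y. y \<in> K \<Longrightarrow> c * (norm y)\<^sup>2 \<le> - Re (form y y)"
    using form_bounds by metis
  have "0 \<le> - Re (form (y - y') (y - y'))"
    using c(2)[OF csubspace_diff[OF csubspace_K vx(2) y'K]] c(1)
    by (smt (verit) mult_nonneg_nonneg zero_le_power2)
  then have "0 \<le> - Re (form y y) + 2 * Re (form y y') - Re (form y' y')"
    using form_commute[of y y'] vx(2) y'K
    by (simp add: form_diff_left form_diff_right K_W csubspace_diff csubspace_W)
  moreover have "- Re (form y' y') \<le> Re (form x x)"
    using U(2) y' by (auto simp: contractive_def)
  ultimately have "Re (form y y + form x x) \<le> 0"
    using 1 by simp
  then show "v \<in> nonpos_cone W form"
    using form_sum_sum[OF vx(1-3) vx(1-3)] vW by (simp add: in_nonpos_cone vx(4))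
qed

text \<open>The subspace in the definition can only be \<open>Domain T\<close>, and closedness of
  \<open>T\<close> is closedness of that domain in the graph norm, so the two cone conditions
  remain.\<close>

lemma signed_boundary_realisation_iff:
  assumes T: "closed_realisation T0 T1 T"
  shows "signed_boundary_realisation T1 W0 form T \<longleftrightarrow>
    Domain T \<subseteq> nonneg_cone W form \<and> form_orthogonal W form (Domain T) \<subseteq> nonpos_cone W form"
proof
  assume "signed_boundary_realisation T1 W0 form T"
  then obtain V where V: "T = restrict_op T1 V" "V \<subseteq> nonneg_cone W form"
      "form_orthogonal W form V \<subseteq> nonpos_cone W form"
    by (auto simp: signed_boundary_realisation_def W)
  then have "Domain T = V"
    using Domain_restrict_op[of V] by (auto simp: nonneg_cone_def)
  then show "Domain T \<subseteq> nonneg_cone W form \<and>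
      form_orthogonal W form (Domain T) \<subseteq> nonpos_cone W form"
    using V by simp
next
  assume cones: "Domain T \<subseteq> nonneg_cone W form \<and>
    form_orthogonal W form (Domain T) \<subseteq> nonpos_cone W form"
  note V = realisation_props[OF T]
  have "u \<in> Domain T" if s: "\<And>n. s n \<in> Domain T" and u: "u \<in> W"
    and lim: "(\<lambda>n. graph_norm T1 (s n - u)) \<longlonglongrightarrow> 0" for s :: "nat \<Rightarrow> 'h" and u
  proof -
    have g: "graph_norm T1 (s n - u) = norm (s n - u) + norm (L (s n) - L u)" for n
      using L_diff[OF subsetD[OF V(3) s] u, of n] by (simp add: graph_norm_def L_def)
    have "(\<lambda>n. s n - u) \<longlonglongrightarrow> 0" "(\<lambda>n. L (s n) - L u) \<longlonglongrightarrow> 0"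
      by (rule Lim_null_comparison[OF _ lim], simp add: g)+
    then show ?thesis
      by (rule realisation_limit[OF T s LIM_zero_cancel LIM_zero_cancel])
  qed
  then have "graph_closed_subspace T1 (Domain T)"
    using V(1,3) by (auto simp: graph_closed_subspace_def W)
  then show "signed_boundary_realisation T1 W0 form T"
    using V(2,4) cones unfolding signed_boundary_realisation_def W by blast
qed

lemma signed_realisation_iff:
  assumes T: "closed_realisation T0 T1 T"
  shows "signed_boundary_realisation T1 W0 form T \<longleftrightarrow>
    (\<exists>U. classifying U \<and> contractive U \<and> Domain U = Kt \<and> Domain T = V_dom W0 U)"
proof
  assume "signed_boundary_realisation T1 W0 form T"
  then have cones: "Domain T \<subseteq> nonneg_cone W form"
      "form_orthogonal W form (Domain T) \<subseteq> nonpos_cone W form"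
    using signed_boundary_realisation_iff[OF T] by auto
  obtain U where U: "classifying U" "contractive U" "Domain T = V_dom W0 U"
    using nonneg_realisation_iff[OF T] cones(1) by blast
  \<comment> \<open>A vector of \<open>Kt\<close> orthogonal to \<open>Domain U\<close> belongs to
    the form complement of \<open>Domain T\<close>, where the form is non-positive; positive
    definiteness on \<open>Kt\<close> makes it 0.\<close>
  have "Domain U = Kt"
  proof (rule Kt_eq_if_no_orthogonal[OF contractive_domain(1)[OF U(1,2)]])
    fix z assume z: "z \<in> Kt" "\<And>x. x \<in> Domain U \<Longrightarrow> form z x = 0"
    then have "Re (form z z) \<le> 0"
      using V_dom_orthogonal_Kt[OF U(1) z] cones(2) U(3) in_nonpos_cone by auto
    then show "z = 0"
      using form_Kt_zero z(1) by blast
  qed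
  then show "\<exists>U. classifying U \<and> contractive U \<and> Domain U = Kt \<and> Domain T = V_dom W0 U"
    using U by blast
next
  assume "\<exists>U. classifying U \<and> contractive U \<and> Domain U = Kt \<and> Domain T = V_dom W0 U"
  then show "signed_boundary_realisation T1 W0 form T"
    using signed_boundary_realisation_iff[OF T] contractive_orthogonal_nonpos
      nonneg_realisation_iff[OF T] by metis
qed

lemma selfadjoint_realisation_iff:
  assumes T: "closed_realisation T0 T1 T"
  shows "Domain T = Domain (adjoint_op T) \<longleftrightarrow>
    (\<exists>U. classifying U \<and> isometric U \<and> Domain U = Kt \<and> Range U = K \<and> Domain T = V_dom W0 U)"
proof
  assume eq: "Domain T = Domain (adjoint_op T)"
  then obtain U where U: "classifying U" "isometric U" "Domain T = V_dom W0 U"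
    using isotropic_realisation_iff[OF T] by blast
  have orth: "form_orthogonal W form (V_dom W0 U) = V_dom W0 U"
    using Domain_adjoint_realisation[OF T] eq U(3) by simp
  \<comment> \<open>\<open>V_dom W0 U\<close> is its own form complement and isotropic. As the form
    is definite on each kernel, no nonzero vector of \<open>Kt\<close> or \<open>K\<close> can be
    orthogonal to the domain or range of \<open>U\<close>, respectively.\<close>
  have null: "form z z = 0" if "z \<in> form_orthogonal W form (V_dom W0 U)" for z
    using V_dom_isotropic_iff[OF U(1)] U(2) that orth by blast
  have "Domain U = Kt"
  proof (rule Kt_eq_if_no_orthogonal[OF contractive_domain(1)[OF U(1)]])
    fix z assume z: "z \<in> Kt" "\<And>x. x \<in> Domain U \<Longrightarrow> form z x = 0"
    then show "z = 0"
      using null[OF V_dom_orthogonal_Kt[OF U(1) z]] form_Kt_zero by simp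
  qed (rule isometric_imp_contractive[OF U(2)])
  moreover have "Range U = K"
  proof (rule K_eq_if_no_orthogonal[OF isometric_range[OF U(1,2)]])
    fix z assume z: "z \<in> K" "\<And>x. x \<in> Range U \<Longrightarrow> form z x = 0"
    then show "z = 0"
      using null[OF V_dom_orthogonal_K[OF U(1) z]] form_K_zero by simp
  qed
  ultimately show "\<exists>U. classifying U \<and> isometric U \<and> Domain U = Kt \<and> Range U = K \<and>
      Domain T = V_dom W0 U"
    using U by blast
next
  assume "\<exists>U. classifying U \<and> isometric U \<and> Domain U = Kt \<and> Range U = K \<and> Domain T = V_dom W0 U"
  then obtain U where U: "classifying U" "isometric U" "Domain U = Kt" "Range U = K"
      "Domain T = V_dom W0 U"
    by blast
  have sub: "Domain T \<subseteq> Domain (adjoint_op T)"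
    using isotropic_realisation_iff[OF T] U by blast
  note V = realisation_props[OF T] and adj = Domain_adjoint_realisation[OF T]
  moreover have "v \<in> Domain T" if v: "v \<in> Domain (adjoint_op T)" for v
  proof -
    have vW: "v \<in> W" and vo: "\<And>u. u \<in> Domain T \<Longrightarrow> form v u = 0"
      using v adj by (auto simp: form_orthogonal_def)
    obtain v0 y x where vx: "v0 \<in> W0" "y \<in> K" "x \<in> Kt" "v = v0 + y + x"
      using W_decomposition[OF vW] by metis
    obtain y' where y': "(x, y') \<in> U"
      using U(3) vx(3) by blast
    then have y'K: "y' \<in> K"
      using U(4) by blast
    \<comment> \<open>\<open>w\<close> differs from \<open>v\<close> only in the \<open>K\<close>
      component, where \<open>y\<close> is replaced by the value of \<open>U\<close> at
      \<open>x\<close>. Surjectivity of \<open>U\<close> supplies a test vector \<open>u\<close> of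
      \<open>Domain T\<close> with \<open>K\<close> component \<open>y - y'\<close>; both
      \<open>v\<close> and \<open>w\<close> are orthogonal to it, and subtraction leaves
      \<open>form (y - y') (y - y') = 0\<close>.\<close>
    define w where "w = v0 + y' + x"
    have w: "w \<in> Domain T"
      unfolding U(5) w_def by (rule V_dom_I[OF U(1) vx(1) y'])
    have d: "y - y' \<in> K"
      by (rule csubspace_diff[OF csubspace_K vx(2) y'K])
    obtain x'' where x'': "(x'', y - y') \<in> U"
      using d U(4) by blast
    have x''Kt: "x'' \<in> Kt"
      using x'' U(3) by blast
    define u where "u = 0 + (y - y') + x''"
    have u: "u \<in> Domain T"
      unfolding U(5) u_def by (rule V_dom_I[OF U(1) csubspace_0[OF csubspace_W0] x''])
    have "form v u = 0" "form w u = 0"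
      using vo[OF u] sub w u adj by (auto simp: form_orthogonal_def)
    then have "form y (y - y') + form x x'' = 0" "form y' (y - y') + form x x'' = 0"
      using form_sum_sum[OF vx(1-3) csubspace_0[OF csubspace_W0] d x''Kt]
        form_sum_sum[OF vx(1) y'K vx(3) csubspace_0[OF csubspace_W0] d x''Kt]
      by (simp_all add: vx(4) w_def u_def)
    then have "form (y - y') (y - y') = 0"
      using form_diff_left[OF K_W[OF vx(2)] K_W[OF y'K] K_W[OF d]]
      by (metis add_right_cancel eq_iff_diff_eq_0)
    then have "y - y' = 0"
      using form_K_zero[OF d] by simp
    then show ?thesis
      using w by (simp add: w_def vx(4))
  qed
  ultimately show "Domain T = Domain (adjoint_op T)"
    using sub by blast
qed

section \<open>Bijective realisations\<close>

lemma bijective_op_iff: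
  assumes T: "closed_realisation T0 T1 T"
  shows "bijective_op T \<longleftrightarrow> inj_on L (Domain T) \<and> L ` Domain T = UNIV"
proof -
  have "app T u = L u" if "u \<in> Domain T" for u
    using T realisation_props(5)[OF T that] by (auto simp: closed_realisation_def linear_op_app_eq)
  then have "bijective_op T \<longleftrightarrow> bij_betw L (Domain T) UNIV"
    unfolding bijective_op_def by (intro bij_betw_cong) auto
  then show ?thesis
    by (simp add: bij_betw_def)
qed

lemma L_components:
  assumes "u0 \<in> W0" "y \<in> K" "x \<in> Kt"
  shows "L (u0 + y + x) = L u0 + S x"
  using assms csubspace_add[OF csubspace_W] by (simp add: L_add W0_W K_W Kt_W K_L Kt_L)

lemma bijective_realisation_iff:
  assumes T: "closed_realisation T0 T1 T"
  shows "bijective_op T \<longleftrightarrow> (\<exists>U. bounded_operator Kt K U \<and> Domain T = V_dom W0 U)"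
proof
  note V = realisation_props[OF T]
  assume "bijective_op T"
  then have inj: "inj_on L (Domain T)" and surj: "L ` Domain T = UNIV"
    using bijective_op_iff[OF T] by auto
  have z: "y = 0" if "y \<in> Domain T" "y \<in> K" for y
    using inj_onD[OF inj, of y 0] that csubspace_0[OF V(1)] by (simp add: K_L L_0)
  obtain U where U: "classifying U" "Domain T = V_dom W0 U"
    by (rule classifying_of_realisation[OF T z])
  have lin: "linear_op U" and sub: "U \<subseteq> Kt \<times> K" and clo: "closed U"
    using U(1) by (auto simp: classifying_def)
  \<comment> \<open>Surjectivity provides \<open>u\<close> in \<open>Domain T\<close> with the same
    image as \<open>x\<close>. The difference lies in \<open>K\<close>, so the \<open>Kt\<close>
    component of \<open>u\<close> is \<open>x\<close> itself, which places \<open>x\<close> in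
    \<open>Domain U\<close>.\<close>
  have full: "Domain U = Kt"
  proof (intro equalityI subsetI)
    fix x assume x: "x \<in> Kt"
    have "L x \<in> L ` Domain T"
      unfolding surj by simp
    then obtain u where u: "u \<in> Domain T" "L u = L x"
      by (metis imageE)
    then obtain u0 y' x' where ux: "u = u0 + y' + x'" "u0 \<in> W0" "(x', y') \<in> U" "x' \<in> Kt" "y' \<in> K"
      using V_dom_E[OF U(1)] U(2) by metis
    have "L (u - x) = 0" "u - x \<in> W"
      using u V(3) Kt_W[OF x] csubspace_diff[OF csubspace_W] by (auto simp: L_diff)
    then have ux': "u - x \<in> K"
      by (simp add: K_iff)
    have "u0 + y' + x' = 0 + (u - x) + x"
      by (simp add: ux(1))
    then have "x' = x"
      using components_unique[OF ux(2,5,4) csubspace_0[OF csubspace_W0] ux' x] by blast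
    then show "x \<in> Domain U"
      using ux(3) by blast
  qed (use sub in blast)
  have "\<exists>C. \<forall>x\<in>Kt. norm (app U x) \<le> C * norm x"
  proof (rule closed_graph_bounded_on[OF csubspace_imp_subspace[OF csubspace_Kt] closed_Kt])
    show "app U (x + y) = app U x + app U y" if "x \<in> Kt" "y \<in> Kt" for x y
      using app_add[OF lin] that full by simp
    show "app U (r *\<^sub>R x) = r *\<^sub>R app U x" if "x \<in> Kt" for r x
      using app_scaleC[OF lin, of x "of_real r"] that full by (simp add: scaleC_of_real)
    have "{(x, app U x) |x. x \<in> Kt} = U"
      using full in_linear_op[OF lin] linear_op_app_eq[OF lin] by fastforce
    then show "closed {(x, app U x) |x. x \<in> Kt}"
      using clo by simp
  qed
  then show "\<exists>U. bounded_operator Kt K U \<and> Domain T = V_dom W0 U"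
    using U lin sub full by (auto simp: bounded_operator_def operator_between_def)
next
  assume "\<exists>U. bounded_operator Kt K U \<and> Domain T = V_dom W0 U"
  then obtain U where b: "bounded_operator Kt K U" and DT: "Domain T = V_dom W0 U"
    by blast
  have U: "classifying U" and full: "Domain U = Kt"
    using classifying_bounded[OF b] b by (auto simp: bounded_operator_def operator_between_def)
  have "u = v" if u: "u \<in> V_dom W0 U" and v: "v \<in> V_dom W0 U" and eq: "L u = L v" for u v
  proof -
    have d: "u - v \<in> V_dom W0 U"
      by (rule csubspace_diff[OF csubspace_V_dom[OF U] u v])
    then obtain u0 y x where ux: "u - v = u0 + y + x" "u0 \<in> W0" "(x, y) \<in> U" "x \<in> Kt" "y \<in> K"
      using V_dom_E[OF U] by metis
    have uv: "u \<in> W" "v \<in> W"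
      using u v V_dom_W[OF U] by auto
    then have "L (u - v) = 0" "u - v \<in> W"
      using eq csubspace_diff[OF csubspace_W] by (auto simp: L_diff)
    then have K: "u - v \<in> K"
      by (simp add: K_iff)
    have "u0 + y + x = 0 + (u - v) + 0"
      by (simp add: ux(1))
    then have "x = 0" "y = u - v"
      using components_unique[OF ux(2,5,4) csubspace_0[OF csubspace_W0] K csubspace_0[OF csubspace_Kt]]
      by auto
    \<comment> \<open>A vector of \<open>V_dom W0 U\<close> that lies in \<open>K\<close> has
      \<open>Kt\<close> component 0, so it is a value of \<open>U\<close> at 0.\<close>
    then have "(0, u - v) \<in> U"
      using ux(3) by simp
    moreover have "(0, 0) \<in> U" "single_valued U"
      using U csubspace_0[of U] by (auto simp: classifying_def linear_op_def zero_prod_def)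
    ultimately have "u - v = 0"
      by (metis single_valuedD)
    then show "u = v"
      by simp
  qed
  then have "inj_on L (V_dom W0 U)"
    by (intro inj_onI) blast
  moreover have "f \<in> L ` V_dom W0 U" for f
  proof -
    obtain u0 x where ux: "u0 \<in> W0" "x \<in> Kt" "L u0 + S x = f"
      using reference_surjective by blast
    then obtain y where y: "(x, y) \<in> U"
      using full by blast
    then have "y \<in> K"
      using U by (auto simp: classifying_def)
    \<comment> \<open>Adding \<open>y\<close> from the kernel of \<open>T1\<close> leaves the image
      of the reference solution unchanged.\<close>
    then have "L (u0 + y + x) = f"
      using L_components ux by simp
    then show ?thesis
      using V_dom_I[OF U ux(1) y] by blast
  qed
  ultimately show "bijective_op T"
    unfolding bijective_op_iff[OF T] DT by (intro conjI) auto
qed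

section \<open>The operator classes of the theorem as conditions on closed graphs\<close>

lemma nonexpansive_subspace_iff:
  "(\<exists>G. closed_subspace_of G Kt \<and> nonexpansive_operator G form K (\<lambda>u v. - form u v) U) \<longleftrightarrow>
    classifying U \<and> contractive U"
  using classifying_contractive contractive_domain nonexpansive_iff by metis

lemma nonexpansive_full_iff:
  "nonexpansive_operator Kt form K (\<lambda>u v. - form u v) U \<longleftrightarrow>
    classifying U \<and> contractive U \<and> Domain U = Kt"
proof
  assume "nonexpansive_operator Kt form K (\<lambda>u v. - form u v) U"
  then have U: "operator_between Kt K U" "contractive U"
    by (simp_all add: nonexpansive_iff)
  then show "classifying U \<and> contractive U \<and> Domain U = Kt"
    using classifying_contractive[OF closed_subspace_Kt U] by (simp add: operator_between_def)
next
  assume "classifying U \<and> contractive U \<and> Domain U = Kt"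
  then show "nonexpansive_operator Kt form K (\<lambda>u v. - form u v) U"
    using contractive_domain(2)[of U] by (auto simp: nonexpansive_iff)
qed

lemma unitary_imp_classifying:
  assumes "closed_subspace_of G Kt" "H \<subseteq> K" "unitary_operator G form H (\<lambda>u v. - form u v) U"
  shows "classifying U \<and> isometric U"
  using assms classifying_contractive[OF assms(1), of U] isometric_imp_contractive
  by (auto simp: unitary_iff operator_between_def)

lemma unitary_subspace_iff:
  "(\<exists>G H. closed_subspace_of G Kt \<and> closed_subspace_of H K \<and>
      unitary_operator G form H (\<lambda>u v. - form u v) U) \<longleftrightarrow> classifying U \<and> isometric U"
proof
  assume "classifying U \<and> isometric U"
  then show "\<exists>G H. closed_subspace_of G Kt \<and> closed_subspace_of H K \<and>
      unitary_operator G form H (\<lambda>u v. - form u v) U"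
    using contractive_domain[OF _ isometric_imp_contractive, of U] isometric_range[of U]
    by (intro exI[of _ "Domain U"] exI[of _ "Range U"])
      (auto simp: unitary_iff operator_between_def)
next
  assume "\<exists>G H. closed_subspace_of G Kt \<and> closed_subspace_of H K \<and>
      unitary_operator G form H (\<lambda>u v. - form u v) U"
  then obtain G H where "closed_subspace_of G Kt" "H \<subseteq> K"
      "unitary_operator G form H (\<lambda>u v. - form u v) U"
    unfolding closed_subspace_of_def[of _ K] by blast
  then show "classifying U \<and> isometric U"
    by (rule unitary_imp_classifying)
qed

lemma unitary_full_iff:
  "unitary_operator Kt form K (\<lambda>u v. - form u v) U \<longleftrightarrow>
    classifying U \<and> isometric U \<and> Domain U = Kt \<and> Range U = K"
proof
  assume u: "unitary_operator Kt form K (\<lambda>u v. - form u v) U"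
  then show "classifying U \<and> isometric U \<and> Domain U = Kt \<and> Range U = K"
    using unitary_imp_classifying[OF closed_subspace_Kt order_refl u]
    by (simp add: unitary_iff operator_between_def)
next
  assume "classifying U \<and> isometric U \<and> Domain U = Kt \<and> Range U = K"
  then show "unitary_operator Kt form K (\<lambda>u v. - form u v) U"
    by (simp add: unitary_iff operator_between_def classifying_def)
qed

end

theorem theorem4p7:
  fixes T0 Tt0 T1 Tt1 :: "'h::chilbert_space operator"
    and W0 W K Kt :: "'h set"
    and form :: "'h \<Rightarrow> 'h \<Rightarrow> complex"
  assumes pair: "joint_friedrichs_pair T0 Tt0"
    and T1: "T1 = adjoint_op Tt0" and Tt1: "Tt1 = adjoint_op T0"
    and W0: "W0 = Domain (closure T0)" and W: "W = Domain T1"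
    and K: "K = ker T1" and Kt: "Kt = ker Tt1"
    and form: "form = boundary_form T1 Tt1"
  shows
    "(\<forall>T. closed_realisation T0 T1 T \<longrightarrow>
      (bijective_op T \<longleftrightarrow>
        (\<exists>U. bounded_operator Kt K U \<and> Domain T = V_dom W0 U)) \<and>
      (Domain T \<subseteq> nonneg_cone W form \<longleftrightarrow>
        (\<exists>Gt U. closed_subspace_of Gt Kt \<and>
          nonexpansive_operator Gt form K (\<lambda>u v. - form u v) U \<and> Domain T = V_dom W0 U)) \<and>
      (signed_boundary_realisation T1 W0 form T \<longleftrightarrow>
        (\<exists>U. nonexpansive_operator Kt form K (\<lambda>u v. - form u v) U \<and>
          Domain T = V_dom W0 U)) \<and>
      (Domain T \<subseteq> Domain (adjoint_op T) \<longleftrightarrow>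
        (\<exists>Gt G U. closed_subspace_of Gt Kt \<and> closed_subspace_of G K \<and>
          unitary_operator Gt form G (\<lambda>u v. - form u v) U \<and> Domain T = V_dom W0 U)) \<and>
      (Domain T = Domain (adjoint_op T) \<longleftrightarrow>
        (\<exists>U. unitary_operator Kt form K (\<lambda>u v. - form u v) U \<and> Domain T = V_dom W0 U))) \<and>
    classifies T1 W0
      {U. bounded_operator Kt K U}
      {T. closed_realisation T0 T1 T \<and> bijective_op T} \<and>
    classifies T1 W0
      {U. \<exists>Gt. closed_subspace_of Gt Kt \<and>
        nonexpansive_operator Gt form K (\<lambda>u v. - form u v) U}
      {T. closed_realisation T0 T1 T \<and> Domain T \<subseteq> nonneg_cone W form} \<and>
    classifies T1 W0
      {U. nonexpansive_operator Kt form K (\<lambda>u v. - form u v) U}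
      {T. closed_realisation T0 T1 T \<and> signed_boundary_realisation T1 W0 form T} \<and>
    classifies T1 W0
      {U. \<exists>Gt G. closed_subspace_of Gt Kt \<and> closed_subspace_of G K \<and>
        unitary_operator Gt form G (\<lambda>u v. - form u v) U}
      {T. closed_realisation T0 T1 T \<and> Domain T \<subseteq> Domain (adjoint_op T)} \<and>
    classifies T1 W0
      {U. unitary_operator Kt form K (\<lambda>u v. - form u v) U}
      {T. closed_realisation T0 T1 T \<and> Domain T = Domain (adjoint_op T)}"
proof -
  interpret friedrichs_pair T0 Tt0 T1 Tt1 W0 W K Kt form
    by (rule friedrichs_pair.intro) (fact assms)+
  let ?neg = "\<lambda>u v. - form u v"
  have ii: "Domain T \<subseteq> nonneg_cone W form \<longleftrightarrow>
      (\<exists>Gt U. closed_subspace_of Gt Kt \<and> nonexpansive_operator Gt form K ?neg U \<and>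
        Domain T = V_dom W0 U)" if "closed_realisation T0 T1 T" for T
    using nonneg_realisation_iff[OF that] nonexpansive_subspace_iff by metis
  have iii: "signed_boundary_realisation T1 W0 form T \<longleftrightarrow>
      (\<exists>U. nonexpansive_operator Kt form K ?neg U \<and> Domain T = V_dom W0 U)"
    if "closed_realisation T0 T1 T" for T
    using signed_realisation_iff[OF that] nonexpansive_full_iff by metis
  have iv: "Domain T \<subseteq> Domain (adjoint_op T) \<longleftrightarrow>
      (\<exists>Gt G U. closed_subspace_of Gt Kt \<and> closed_subspace_of G K \<and>
        unitary_operator Gt form G ?neg U \<and> Domain T = V_dom W0 U)"
    if "closed_realisation T0 T1 T" for T
    using isotropic_realisation_iff[OF that] unitary_subspace_iff by metis
  have v: "Domain T = Domain (adjoint_op T) \<longleftrightarrow>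
      (\<exists>U. unitary_operator Kt form K ?neg U \<and> Domain T = V_dom W0 U)"
    if "closed_realisation T0 T1 T" for T
    using selfadjoint_realisation_iff[OF that] unitary_full_iff by metis
  show ?thesis
  proof (intro conjI allI impI)
    show "classifies T1 W0 {U. bounded_operator Kt K U}
        {T. closed_realisation T0 T1 T \<and> bijective_op T}"
      by (rule classifies_if) (simp_all add: classifying_bounded bijective_realisation_iff)
    show "classifies T1 W0
        {U. \<exists>Gt. closed_subspace_of Gt Kt \<and> nonexpansive_operator Gt form K ?neg U}
        {T. closed_realisation T0 T1 T \<and> Domain T \<subseteq> nonneg_cone W form}"
      by (rule classifies_if)
        (simp_all add: nonexpansive_subspace_iff nonneg_realisation_iff conj_assoc)
    show "classifies T1 W0 {U. nonexpansive_operator Kt form K ?neg U}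
        {T. closed_realisation T0 T1 T \<and> signed_boundary_realisation T1 W0 form T}"
      by (rule classifies_if)
        (simp_all add: nonexpansive_full_iff signed_realisation_iff conj_assoc)
    show "classifies T1 W0
        {U. \<exists>Gt G. closed_subspace_of Gt Kt \<and> closed_subspace_of G K \<and>
          unitary_operator Gt form G ?neg U}
        {T. closed_realisation T0 T1 T \<and> Domain T \<subseteq> Domain (adjoint_op T)}"
      unfolding unitary_subspace_iff
      by (rule classifies_if) (simp_all add: isotropic_realisation_iff conj_assoc)
    show "classifies T1 W0 {U. unitary_operator Kt form K ?neg U}
        {T. closed_realisation T0 T1 T \<and> Domain T = Domain (adjoint_op T)}"
      by (rule classifies_if)
        (simp_all add: unitary_full_iff selfadjoint_realisation_iff conj_assoc)
  qed (fact bijective_realisation_iff ii iii iv v)+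
qed

end
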